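(* Let $d\ge1$. For all $\mu,\tilde\mu,\nu\in\mathcal P_2(\mathbb R^d)$, $$\mathcal W_2\big(\mathcal I_2(\mu,\nu),\mathcal I_2(\tilde\mu,\nu)\big)\le \overline{\mathcal W}_2(\mu,\tilde\mu).$$
   Context: $\mathcal P_2(\mathbb R^d)$ is the set of probability measures on $\mathbb R^d$ with finite second moment and $\mathcal W_2$ is the quadratic Wasserstein distance, $\mathcal W_2^2(\mu,\nu)=\inf_{\pi}\int|x-y|^2\pi(dx,dy)$ over couplings $\pi$ of $\mu$ and $\nu$. For $\eta\in\mathcal P_2(\mathbb R^d)$, $m(\eta)=\int x\,\eta(dx)$. The centered Wasserstein distance is $\overline{\mathcal W}_2(\mu,\nu)=\left(\mathcal W_2^2(\mu,\nu)-|m(\mu)-m(\nu)|^2\right)^{1/2}$. The convex order is defined by $\mu\le_{cx}\nu$ iff $\int f\,d\mu\le\int f\,d\nu$ for every convex $f:\mathbb R^d\to\mathbb R$. $\mathcal I_2(\mu,\nu)$ denotes the (existing and unique) minimizer of $\eta\mapsto\mathcal W_2(\mu,\eta)$ over $\{\eta\in\mathcal P_2(\mathbb R^d):\eta\le_{cx}\nu\}$. *)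

theory Defs
  imports "HOL-Probability.Probability"
begin

definition P2 :: "'a::euclidean_space measure set" where
  "P2 = {\<mu>. prob_space \<mu> \<and> sets \<mu> = sets borel \<and> integrable \<mu> (\<lambda>x. (norm x)\<^sup>2)}"

definition couplings ::
  "'a::euclidean_space measure \<Rightarrow> 'a measure \<Rightarrow> ('a \<times> 'a) measure set" where
  "couplings \<mu> \<nu> = {\<pi>. sets \<pi> = sets (borel \<Otimes>\<^sub>M borel)
      \<and> distr \<pi> borel fst = \<mu> \<and> distr \<pi> borel snd = \<nu>}"

text \<open>For measures in \<^const>\<open>P2\<close> the cost is integrable under every coupling and the set of
  couplings contains the product measure, so the Bochner integral and the real-valued infimum
  below carry no junk values.\<close>

definition W2 :: "'a::euclidean_space measure \<Rightarrow> 'a measure \<Rightarrow> real" where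
  "W2 \<mu> \<nu> = sqrt (INF \<pi>\<in>couplings \<mu> \<nu>. \<integral>z. (norm (fst z - snd z))\<^sup>2 \<partial>\<pi>)"

definition mean :: "'a::euclidean_space measure \<Rightarrow> 'a" where
  "mean \<eta> = (\<integral>x. x \<partial>\<eta>)"

definition centered_W2 :: "'a::euclidean_space measure \<Rightarrow> 'a measure \<Rightarrow> real" where
  "centered_W2 \<mu> \<nu> = sqrt ((W2 \<mu> \<nu>)\<^sup>2 - (norm (mean \<mu> - mean \<nu>))\<^sup>2)"

text \<open>A convex function need not be integrable against a measure in \<^const>\<open>P2\<close>, but it has an
  affine minorant, so its integral exists in the half-open range from minus infinity (excluded) to
  plus infinity (included). Comparing Bochner integrals would give the wrong order, as these are
  zero for non-integrable functions; hence the extended-real integral, the difference of the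
  integrals of the positive and the negative part (\<^const>\<open>ennreal\<close> truncates negative arguments
  to zero).\<close>

definition ereal_integral :: "'a measure \<Rightarrow> ('a \<Rightarrow> real) \<Rightarrow> ereal" where
  "ereal_integral M f =
     enn2ereal (\<integral>\<^sup>+x. ennreal (f x) \<partial>M) - enn2ereal (\<integral>\<^sup>+x. ennreal (- f x) \<partial>M)"

definition convex_order :: "'a::euclidean_space measure \<Rightarrow> 'a measure \<Rightarrow> bool"
    (infix "\<le>cx" 50) where
  "\<mu> \<le>cx \<nu> \<longleftrightarrow> (\<forall>f. convex_on UNIV f \<longrightarrow> ereal_integral \<mu> f \<le> ereal_integral \<nu> f)"

definition I2 :: "'a::euclidean_space measure \<Rightarrow> 'a measure \<Rightarrow> 'a measure" where
  "I2 \<mu> \<nu> = (THE \<eta>. is_arg_min (W2 \<mu>) (\<lambda>\<eta>. \<eta> \<in> P2 \<and> \<eta> \<le>cx \<nu>) \<eta>)"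

end

theory Submission
  imports Defs
begin

text \<open>Over any probability space the square integrable random variables whose law lies below \<open>\<nu>\<close> in
  the convex order form a closed convex subset of the Hilbert space \<open>L\<^sup>2\<close>. Let \<open>T\<close> be the projection of the identity onto that
  set in \<open>L\<^sup>2(\<mu>)\<close>. By conditional Jensen, \<open>T(X)\<close> is the projection of \<open>X\<close> onto the
  corresponding set on every probability space carrying a variable \<open>X\<close> with law \<open>\<mu>\<close>. Hence
  \<open>I\<^sub>2(\<mu>, \<nu>)\<close> is the law of \<open>T(X)\<close>, and for a coupling \<open>(X, X')\<close> the claim is the contraction
  property of the Hilbert space projection. As both projections have the mean of \<open>\<nu>\<close>, the
  difference \<open>X - X'\<close> may be centered first.\<close>

section \<open>Square integrable maps and the convex order\<close>

text \<open>The infimum behind \<open>I2\<close> runs over laws and their couplings with \<mu>, so a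
  competitor is a variable \<open>Y\<close> that need not be a function of \<open>X\<close>, whereas
  \<open>T\<close> is found among functions of \<open>X\<close> only. What bridges the gap is that
  the residual \<open>X - T(X)\<close> is a function of \<open>X\<close>: against it,
  \<open>Y\<close> may be replaced by its averages over cells of \<open>X\<close>, and averaging
  preserves domination. The cells are those of simple approximations to the residual. The
  approximation error is uniformly small because the squared norm is itself a convex test function,
  so all dominated variables share one second moment bound. The resulting inequality holds under
  every coupling, hence the infimum is taken only at the end of each estimate. Since
  \<open>I2\<close> is a definite description, uniqueness has to be proved as well, and this is
  where definiteness of \<open>W2\<close> enters. Convex functions may have infinite integrals.
  Splitting off a supporting affine function leaves equality of means and nonnegative test
  functions, to which Fatou and Jensen apply with infinite values allowed.\<close>

definition square_integrable :: "'b measure \<Rightarrow> ('b \<Rightarrow> 'a::euclidean_space) \<Rightarrow> bool" where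
  "square_integrable M Y \<longleftrightarrow> Y \<in> borel_measurable M \<and> integrable M (\<lambda>x. (norm (Y x))\<^sup>2)"

lemma square_integrable_measurable: "square_integrable M Y \<Longrightarrow> Y \<in> borel_measurable M"
  and square_integrable_norm: "square_integrable M Y \<Longrightarrow> integrable M (\<lambda>x. (norm (Y x))\<^sup>2)"
  by (auto simp: square_integrable_def)

lemma square_integrable_norm_mult:
  assumes "square_integrable M X" "square_integrable M Y"
  shows "integrable M (\<lambda>x. norm (X x) * norm (Y x))"
proof (rule Bochner_Integration.integrable_bound)
  show "integrable M (\<lambda>x. (norm (X x))\<^sup>2 + (norm (Y x))\<^sup>2)"
    using assms by (intro Bochner_Integration.integrable_add square_integrable_norm)
  show "(\<lambda>x. norm (X x) * norm (Y x)) \<in> borel_measurable M"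
    using assms[THEN square_integrable_measurable] by measurable
  have "\<bar>a * b\<bar> \<le> a\<^sup>2 + b\<^sup>2" for a b :: real
  proof -
    have "2 * \<bar>a * b\<bar> \<le> a\<^sup>2 + b\<^sup>2"
      using sum_squares_bound[of "\<bar>a\<bar>" "\<bar>b\<bar>"] by (simp add: abs_mult)
    then show ?thesis using abs_ge_zero[of "a * b"] by linarith
  qed
  then show "AE x in M. norm (norm (X x) * norm (Y x)) \<le> norm ((norm (X x))\<^sup>2 + (norm (Y x))\<^sup>2)"
    by (intro AE_I2) (metis abs_of_nonneg real_norm_def sum_power2_ge_zero)
qed

lemma square_integrable_inner:
  assumes "square_integrable M X" "square_integrable M Y"
  shows "integrable M (\<lambda>x. X x \<bullet> Y x)"
proof (rule Bochner_Integration.integrable_bound[OF square_integrable_norm_mult[OF assms]])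
  show "(\<lambda>x. X x \<bullet> Y x) \<in> borel_measurable M"
    using assms[THEN square_integrable_measurable] by measurable
qed (auto simp: abs_mult Cauchy_Schwarz_ineq2)

lemma square_integrable_scaleR:
  "square_integrable M X \<Longrightarrow> square_integrable M (\<lambda>x. c *\<^sub>R X x)"
  by (auto simp: square_integrable_def power_mult_distrib)

lemma square_integrable_add:
  assumes "square_integrable M X" "square_integrable M Y"
  shows "square_integrable M (\<lambda>x. X x + Y x)"
proof -
  have "(norm (X x + Y x))\<^sup>2 = (norm (X x))\<^sup>2 + 2 * (X x \<bullet> Y x) + (norm (Y x))\<^sup>2" for x
    by (simp add: power2_norm_eq_inner inner_add inner_commute)
  then show ?thesis
    using assms square_integrable_inner[OF assms] by (auto simp: square_integrable_def)
qed

lemma square_integrable_diff: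
  assumes "square_integrable M X" "square_integrable M Y"
  shows "square_integrable M (\<lambda>x. X x - Y x)"
  using square_integrable_add[OF assms(1) square_integrable_scaleR[OF assms(2), of "-1"]] by simp

lemma (in finite_measure) square_integrable_const: "square_integrable M (\<lambda>x. c)"
  by (simp add: square_integrable_def)

lemma (in finite_measure) square_integrable_integrable:
  assumes "square_integrable M X"
  shows "integrable M X"
proof (rule Bochner_Integration.integrable_bound)
  show "integrable M (\<lambda>x. 1 + (norm (X x))\<^sup>2)"
    using square_integrable_norm[OF assms] by simp
  have "norm a \<le> 1 + (norm a)\<^sup>2" for a :: 'b
    using sum_squares_bound[of 1 "norm a"] zero_le_power2[of "norm a"] norm_ge_zero[of a]
    unfolding one_power2 by linarith
  then show "AE x in M. norm (X x) \<le> norm (1 + (norm (X x))\<^sup>2)"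
    by (intro AE_I2) (metis abs_of_nonneg real_norm_def sum_power2_ge_zero one_power2)
qed (rule square_integrable_measurable[OF assms])

section \<open>Supporting affine functions and extended-real integrals\<close>

text \<open>The epigraph is separated from the open vertical half-line below
  \<open>(x, f x)\<close>. The last coordinate \<beta> of the normal is nonnegative; \<beta> = 0
  would mean a vertical hyperplane, which the point \<open>x - a\<close> rules out. The slope is
  then \<open>- a\<close> divided by \<beta>.\<close>

lemma convex_on_subgradient:
  fixes f :: "'a::euclidean_space \<Rightarrow> real"
  assumes "convex_on UNIV f"
  obtains p where "\<And>y. f x + p \<bullet> (y - x) \<le> f y"
proof -
  obtain c b where c: "c \<noteq> 0"
    and lo: "\<And>z. z \<in> {x} \<times> {..<f x} \<Longrightarrow> c \<bullet> z \<le> b"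
    and up: "\<And>z. z \<in> epigraph UNIV f \<Longrightarrow> c \<bullet> z \<ge> b"
  proof -
    have "convex ({x} \<times> {..<f x})" by (intro convex_Times) auto
    moreover have "(x, f x - 1) \<in> {x} \<times> {..<f x}" "(x, f x) \<in> epigraph UNIV f"
      "{x} \<times> {..<f x} \<inter> epigraph UNIV f = {}"
      by (auto simp: epigraph_def)
    ultimately show ?thesis
      using separating_hyperplane_sets[OF _ convex_epigraphI[OF assms], of "{x} \<times> {..<f x}"] that
      by (metis empty_iff)
  qed
  obtain a \<beta> where ab: "c = (a, \<beta>)" by (cases c)
  have lo': "a \<bullet> x + \<beta> * t \<le> b" if "t < f x" for t
    using lo[of "(x, t)"] that by (simp add: ab)
  have up': "b \<le> a \<bullet> y + \<beta> * s" if "f y \<le> s" for y s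
    using up[of "(y, s)"] that by (simp add: ab epigraph_def)
  have "\<beta> \<ge> 0"
    using lo'[of "f x - 1"] up'[of x "f x"] by (simp add: algebra_simps)
  moreover have "\<beta> \<noteq> 0"
  proof
    assume "\<beta> = 0"
    then have "a \<bullet> a \<le> 0"
      using lo'[of "f x - 1"] up'[of "x - a" "f (x - a)"] by (simp add: inner_diff)
    then have "a = 0" by (metis inner_gt_zero_iff linorder_not_less)
    with c ab \<open>\<beta> = 0\<close> show False by (simp add: zero_prod_def)
  qed
  ultimately have pos: "\<beta> > 0" by simp
  have lox: "a \<bullet> x + \<beta> * f x \<le> b"
  proof (rule field_le_epsilon)
    fix e :: real assume "e > 0"
    then show "a \<bullet> x + \<beta> * f x \<le> b + e"
      using lo'[of "f x - e / \<beta>"] pos by (simp add: algebra_simps)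
  qed
  have "f x + (- a /\<^sub>R \<beta>) \<bullet> (y - x) \<le> f y" for y
    using order_trans[OF lox up'[of y "f y"]] pos
    by (simp add: inner_diff field_simps)
  then show thesis by (rule that)
qed

lemma convex_on_borel_measurable:
  fixes f :: "'a::euclidean_space \<Rightarrow> real"
  assumes "convex_on UNIV f"
  shows "f \<in> borel_measurable borel"
  using assms by (intro borel_measurable_continuous_onI convex_on_continuous) auto

text \<open>An integrable minorant bounds the negative part of \<open>f\<close>, so infinity minus
  infinity cannot occur. If two measures give \<open>l\<close> the same integral, comparing
  \<open>f\<close> under them becomes comparing the nonnegative function
  \<open>f - l\<close>.\<close>

lemma ereal_integral_affine_minorant:
  assumes [measurable]: "f \<in> borel_measurable M" and l: "integrable M l"
    and le: "\<And>x. l x \<le> f x"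
  shows "ereal_integral M f = enn2ereal (\<integral>\<^sup>+x. ennreal (f x - l x) \<partial>M) + ereal (\<integral>x. l x \<partial>M)"
proof -
  have [measurable]: "l \<in> borel_measurable M" using l by simp
  have abs: "(\<integral>\<^sup>+x. ennreal \<bar>l x\<bar> \<partial>M) < \<infinity>"
    using l by (simp add: integrable_iff_bounded)
  have "(\<integral>\<^sup>+x. ennreal (- f x) \<partial>M) \<le> (\<integral>\<^sup>+x. ennreal \<bar>l x\<bar> \<partial>M)"
  proof (intro nn_integral_mono ennreal_leI)
    show "- f x \<le> \<bar>l x\<bar>" for x
      using le[of x] by linarith
  qed
  with abs have neg: "(\<integral>\<^sup>+x. ennreal (- f x) \<partial>M) < \<infinity>" by simp
  show ?thesis
  proof (cases "(\<integral>\<^sup>+x. ennreal (f x) \<partial>M) = \<infinity>")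
    case False
    have "integrable M f"
      using False neg by (simp add: real_integrable_def)
    moreover have "(\<integral>\<^sup>+x. ennreal (f x - l x) \<partial>M) = ennreal (\<integral>x. f x - l x \<partial>M)"
      using \<open>integrable M f\<close> l le by (intro nn_integral_eq_integral) auto
    moreover have "(\<integral>x. f x - l x \<partial>M) \<ge> 0"
      using le by (intro Bochner_Integration.integral_nonneg) auto
    ultimately have "enn2ereal (\<integral>\<^sup>+x. ennreal (f x - l x) \<partial>M) + ereal (\<integral>x. l x \<partial>M) = ereal (\<integral>x. f x \<partial>M)"
      using l by (simp add: enn2ereal_ennreal)
    moreover have "ereal_integral M f = ereal (\<integral>x. f x \<partial>M)"
    proof -
      obtain a where a: "(\<integral>\<^sup>+x. ennreal (f x) \<partial>M) = ennreal a" "0 \<le> a"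
        using False by (metis ennreal_cases infinity_ennreal_def)
      obtain b where b: "(\<integral>\<^sup>+x. ennreal (- f x) \<partial>M) = ennreal b" "0 \<le> b"
        using neg by (metis ennreal_cases infinity_ennreal_def less_irrefl)
      show ?thesis
        unfolding real_lebesgue_integral_def[OF \<open>integrable M f\<close>] ereal_integral_def a b
        using a(2) b(2) by (simp add: enn2ereal_ennreal)
    qed
    ultimately show ?thesis by simp
  next
    case True
    have "(\<integral>\<^sup>+x. ennreal (f x) \<partial>M) \<le> (\<integral>\<^sup>+x. ennreal (f x - l x) + ennreal \<bar>l x\<bar> \<partial>M)"
    proof (intro nn_integral_mono)
      fix x
      have "ennreal (f x) \<le> ennreal (f x - l x + \<bar>l x\<bar>)"
        by (intro ennreal_leI) linarith
      then show "ennreal (f x) \<le> ennreal (f x - l x) + ennreal \<bar>l x\<bar>"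
        using le[of x] by (simp add: ennreal_plus)
    qed
    also have "\<dots> = (\<integral>\<^sup>+x. ennreal (f x - l x) \<partial>M) + (\<integral>\<^sup>+x. ennreal \<bar>l x\<bar> \<partial>M)"
      by (intro nn_integral_add) auto
    finally have "(\<integral>\<^sup>+x. ennreal (f x - l x) \<partial>M) = \<infinity>"
      using True abs by (metis ennreal_add_eq_top infinity_ennreal_def less_irrefl top_unique)
    moreover obtain b where b: "(\<integral>\<^sup>+x. ennreal (- f x) \<partial>M) = ennreal b" "0 \<le> b"
      using neg by (metis ennreal_cases infinity_ennreal_def less_irrefl)
    ultimately show ?thesis
      unfolding ereal_integral_def True b(1) using b(2) by (simp add: enn2ereal_ennreal)
  qed
qed

lemma P2_prob_space: "\<mu> \<in> P2 \<Longrightarrow> prob_space \<mu>"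
  and P2_sets: "\<mu> \<in> P2 \<Longrightarrow> sets \<mu> = sets borel"
  and P2_integrable_norm: "\<mu> \<in> P2 \<Longrightarrow> integrable \<mu> (\<lambda>x. (norm x)\<^sup>2)"
  by (auto simp: P2_def)

lemma P2_square_integrable:
  assumes "\<mu> \<in> P2" shows "square_integrable \<mu> (\<lambda>x. x)"
  using P2_integrable_norm[OF assms] measurable_ident_sets[OF P2_sets[OF assms]]
  by (simp add: square_integrable_def)

lemma P2_integrable:
  assumes "\<mu> \<in> P2" shows "integrable \<mu> (\<lambda>x. x)"
proof -
  interpret prob_space \<mu> using assms by (rule P2_prob_space)
  show ?thesis using P2_square_integrable[OF assms] by (rule square_integrable_integrable)
qed

text \<open>Nonnegative test functions permit the integral in \<open>ennreal\<close>, where infinity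
  is an ordinary value. \<open>Y\<close> is separate from the measure so that one condition serves
  both laws, with \<open>Y\<close> the identity, and random variables on any space.\<close>

definition nn_convex_order :: "'b measure \<Rightarrow> ('b \<Rightarrow> 'a::euclidean_space) \<Rightarrow> 'a measure \<Rightarrow> bool" where
  "nn_convex_order M Y \<nu> \<longleftrightarrow> (\<forall>h. convex_on UNIV h \<longrightarrow> (\<forall>x. 0 \<le> h x) \<longrightarrow>
     (\<integral>\<^sup>+x. ennreal (h (Y x)) \<partial>M) \<le> (\<integral>\<^sup>+x. ennreal (h x) \<partial>\<nu>))"

lemma convex_on_affine: "convex_on UNIV (\<lambda>x::'a::euclidean_space. p \<bullet> x + c)"
  by (intro convex_on_add convex_on_const) (auto simp: convex_on_def inner_add simp flip: distrib_right)

text \<open>Affine functions are convex, and the slope \<open>mean \<eta> - mean \<nu>\<close>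
  forces the means to agree. Conversely, a convex function minus its supporting affine function at 0
  is a nonnegative test function, and equal means give the affine part the same integral under both
  measures.\<close>

lemma convex_order_iff:
  assumes "\<eta> \<in> P2" "\<nu> \<in> P2"
  shows "\<eta> \<le>cx \<nu> \<longleftrightarrow> mean \<eta> = mean \<nu> \<and> nn_convex_order \<eta> (\<lambda>x. x) \<nu>"
proof -
  interpret e: prob_space \<eta> using assms by (simp add: P2_prob_space)
  interpret n: prob_space \<nu> using assms by (simp add: P2_prob_space)
  have m: "h \<in> borel_measurable \<eta>" "h \<in> borel_measurable \<nu>"
    if "h \<in> borel_measurable borel" for h :: "'a \<Rightarrow> real"
    using that measurable_cong_sets[OF assms(1)[THEN P2_sets] refl, of borel]
      measurable_cong_sets[OF assms(2)[THEN P2_sets] refl, of borel] by auto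
  have aff: "integrable \<eta> (\<lambda>x. p \<bullet> x + c)" "integrable \<nu> (\<lambda>x. p \<bullet> x + c)"
    "(\<integral>x. p \<bullet> x + c \<partial>\<eta>) = p \<bullet> mean \<eta> + c" "(\<integral>x. p \<bullet> x + c \<partial>\<nu>) = p \<bullet> mean \<nu> + c" for p c
    using assms[THEN P2_integrable] by (simp_all add: mean_def e.prob_space n.prob_space)
  show ?thesis
  proof
    assume cx: "\<eta> \<le>cx \<nu>"
    have "p \<bullet> mean \<eta> \<le> p \<bullet> mean \<nu>" for p
    proof -
      have "ereal_integral \<eta> (\<lambda>x. p \<bullet> x + 0) \<le> ereal_integral \<nu> (\<lambda>x. p \<bullet> x + 0)"
        using cx convex_on_affine unfolding convex_order_def by blast
      also have "ereal_integral \<nu> (\<lambda>x. p \<bullet> x + 0) = ereal (p \<bullet> mean \<nu> + 0)"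
        by (subst ereal_integral_affine_minorant[OF borel_measurable_integrable aff(2)])
          (use aff in \<open>auto simp only: diff_self ennreal_0 nn_integral_const mult_zero_left zero_ennreal.rep_eq add_0_left order_refl\<close>)
      also have "ereal_integral \<eta> (\<lambda>x. p \<bullet> x + 0) = ereal (p \<bullet> mean \<eta> + 0)"
        by (subst ereal_integral_affine_minorant[OF borel_measurable_integrable aff(1)])
          (use aff in \<open>auto simp only: diff_self ennreal_0 nn_integral_const mult_zero_left zero_ennreal.rep_eq add_0_left order_refl\<close>)
      finally show ?thesis by simp
    qed
    from this[of "mean \<eta> - mean \<nu>"] have "(mean \<eta> - mean \<nu>) \<bullet> (mean \<eta> - mean \<nu>) \<le> 0"
      unfolding inner_diff_right by linarith
    then have "mean \<eta> = mean \<nu>"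
      by (metis inner_gt_zero_iff linorder_not_less right_minus_eq)
    moreover have "nn_convex_order \<eta> (\<lambda>x. x) \<nu>"
      unfolding nn_convex_order_def
    proof (intro allI impI)
      fix h :: "'a \<Rightarrow> real" assume h: "convex_on UNIV h" "\<forall>x. 0 \<le> h x"
      have "ereal_integral \<eta> h \<le> ereal_integral \<nu> h"
        using cx h by (simp add: convex_order_def)
      then show "(\<integral>\<^sup>+x. ennreal (h x) \<partial>\<eta>) \<le> (\<integral>\<^sup>+x. ennreal (h x) \<partial>\<nu>)"
        using ereal_integral_affine_minorant[OF m(1)[OF convex_on_borel_measurable[OF h(1)]], of "\<lambda>x. 0"]
          ereal_integral_affine_minorant[OF m(2)[OF convex_on_borel_measurable[OF h(1)]], of "\<lambda>x. 0"] h(2)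
        by (simp add: less_eq_ennreal.rep_eq)
    qed
    ultimately show "mean \<eta> = mean \<nu> \<and> nn_convex_order \<eta> (\<lambda>x. x) \<nu>" ..
  next
    assume R: "mean \<eta> = mean \<nu> \<and> nn_convex_order \<eta> (\<lambda>x. x) \<nu>"
    show "\<eta> \<le>cx \<nu>"
      unfolding convex_order_def
    proof (intro allI impI)
      fix f :: "'a \<Rightarrow> real" assume f: "convex_on UNIV f"
      obtain p where "\<And>y. f 0 + p \<bullet> (y - 0) \<le> f y"
        using convex_on_subgradient[OF f] by blast
      then have p: "p \<bullet> y + f 0 \<le> f y" for y by (simp add: add.commute)
      have "convex_on UNIV (\<lambda>x. f x - (p \<bullet> x + f 0))"
        using convex_on_add[OF f convex_on_affine[of "-p" "- f 0"]] by (simp add: algebra_simps)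
      with R p have "(\<integral>\<^sup>+x. ennreal (f x - (p \<bullet> x + f 0)) \<partial>\<eta>) \<le> (\<integral>\<^sup>+x. ennreal (f x - (p \<bullet> x + f 0)) \<partial>\<nu>)"
        unfolding nn_convex_order_def by (metis diff_ge_0_iff_ge)
      then show "ereal_integral \<eta> f \<le> ereal_integral \<nu> f"
        using R ereal_integral_affine_minorant[OF m(1)[OF convex_on_borel_measurable[OF f]] aff(1) p]
          ereal_integral_affine_minorant[OF m(2)[OF convex_on_borel_measurable[OF f]] aff(2) p]
        by (simp only: aff less_eq_ennreal.rep_eq add_right_mono)
    qed
  qed
qed

section \<open>Random variables dominated in the convex order\<close>

lemma norm_add_scaleR_power2:
  fixes a b :: "'a::real_inner"
  shows "(norm (a + t *\<^sub>R b))\<^sup>2 = (norm a)\<^sup>2 + 2 * t * (a \<bullet> b) + t\<^sup>2 * (norm b)\<^sup>2"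
  unfolding power2_norm_eq_inner
  by (simp add: inner_add_left inner_add_right inner_commute[of b a] power2_eq_square algebra_simps)

lemma convex_on_power2_norm: "convex_on UNIV (\<lambda>x::'a::euclidean_space. (norm x)\<^sup>2)"
proof (rule convex_onI)
  fix t :: real and x y :: 'a assume t: "0 < t" "t < 1"
  have "(1 - t) *\<^sub>R x + t *\<^sub>R y = x + t *\<^sub>R (y - x)" by (simp add: algebra_simps)
  then have "(norm ((1 - t) *\<^sub>R x + t *\<^sub>R y))\<^sup>2
      = (norm x)\<^sup>2 + 2 * t * (x \<bullet> (y - x)) + t\<^sup>2 * (norm (y - x))\<^sup>2"
    by (simp only: norm_add_scaleR_power2)
  moreover have "(norm y)\<^sup>2 = (norm x)\<^sup>2 + 2 * (x \<bullet> (y - x)) + (norm (y - x))\<^sup>2"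
    using norm_add_scaleR_power2[of x 1 "y - x"] by simp
  moreover have "t\<^sup>2 * (norm (y - x))\<^sup>2 \<le> t * (norm (y - x))\<^sup>2"
    using t by (intro mult_right_mono) (auto simp: power2_eq_square)
  moreover have "A + 2 * t * p + t\<^sup>2 * q \<le> (1 - t) * A + t * (A + 2 * p + q)" if "t\<^sup>2 * q \<le> t * q" for A p q
    using that by (simp add: algebra_simps)
  ultimately show "(norm ((1 - t) *\<^sub>R x + t *\<^sub>R y))\<^sup>2 \<le> (1 - t) * (norm x)\<^sup>2 + t * (norm y)\<^sup>2"
    by (simp only:)
qed auto

text \<open>For a random variable with second moment this says that its law lies below \<open>\<nu>\<close> in the
  convex order, but without reference to the law.\<close>

definition cx_dominated :: "'a::euclidean_space measure \<Rightarrow> 'b measure \<Rightarrow> ('b \<Rightarrow> 'a) \<Rightarrow> bool" where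
  "cx_dominated \<nu> M Y \<longleftrightarrow> Y \<in> borel_measurable M \<and> (\<integral>x. Y x \<partial>M) = mean \<nu> \<and> nn_convex_order M Y \<nu>"

lemma cx_dominated_measurable: "cx_dominated \<nu> M Y \<Longrightarrow> Y \<in> borel_measurable M"
  and cx_dominated_mean: "cx_dominated \<nu> M Y \<Longrightarrow> (\<integral>x. Y x \<partial>M) = mean \<nu>"
  and cx_dominated_le: "cx_dominated \<nu> M Y \<Longrightarrow> convex_on UNIV h \<Longrightarrow> (\<And>x. 0 \<le> h x) \<Longrightarrow>
    (\<integral>\<^sup>+x. ennreal (h (Y x)) \<partial>M) \<le> (\<integral>\<^sup>+x. ennreal (h x) \<partial>\<nu>)"
  by (auto simp: cx_dominated_def nn_convex_order_def)

text \<open>The squared norm is a nonnegative convex test function. The bound depends on \<nu>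
  alone, which later makes approximation errors uniform over all dominated variables.\<close>

lemma cx_dominated_square_integrable:
  assumes "\<nu> \<in> P2" and Y: "cx_dominated \<nu> M Y"
  shows "square_integrable M Y" and "(\<integral>x. (norm (Y x))\<^sup>2 \<partial>M) \<le> (\<integral>x. (norm x)\<^sup>2 \<partial>\<nu>)"
proof -
  have [measurable]: "Y \<in> borel_measurable M" using Y by (rule cx_dominated_measurable)
  have fin: "(\<integral>\<^sup>+x. ennreal ((norm x)\<^sup>2) \<partial>\<nu>) = ennreal (\<integral>x. (norm x)\<^sup>2 \<partial>\<nu>)"
    using P2_integrable_norm[OF assms(1)] by (intro nn_integral_eq_integral) auto
  have le: "(\<integral>\<^sup>+x. ennreal ((norm (Y x))\<^sup>2) \<partial>M) \<le> ennreal (\<integral>x. (norm x)\<^sup>2 \<partial>\<nu>)"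
    using cx_dominated_le[OF Y convex_on_power2_norm] fin by simp
  then have i: "integrable M (\<lambda>x. (norm (Y x))\<^sup>2)"
    by (intro integrableI_nonneg) (auto intro: le_less_trans)
  then show "square_integrable M Y" by (simp add: square_integrable_def)
  show "(\<integral>x. (norm (Y x))\<^sup>2 \<partial>M) \<le> (\<integral>x. (norm x)\<^sup>2 \<partial>\<nu>)"
    using le nn_integral_eq_integral[OF i] by (simp add: ennreal_le_iff)
qed

text \<open>Jensen's inequality on the cell \<open>A\<close>: the supporting affine function at the
  conditional mean is integrated over \<open>A\<close>, where its linear part cancels. Scaling by
  \<open>prob A\<close> makes the bounds summable over a partition.\<close>

lemma (in prob_space) convex_conditional_mean_le:
  fixes Y :: "'a \<Rightarrow> 'b::euclidean_space"
  assumes Y: "integrable M Y" and A: "A \<in> events" "prob A > 0"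
    and h: "convex_on UNIV h" "\<And>x. 0 \<le> h x"
  shows "ennreal (prob A * h ((\<integral>x. indicat_real A x *\<^sub>R Y x \<partial>M) /\<^sub>R prob A))
    \<le> (\<integral>\<^sup>+x. ennreal (h (Y x)) * indicator A x \<partial>M)"
proof (cases "(\<integral>\<^sup>+x. ennreal (h (Y x)) * indicator A x \<partial>M) = \<infinity>")
  case False
  have [measurable]: "h \<in> borel_measurable borel" "Y \<in> borel_measurable M" "A \<in> events"
    using convex_on_borel_measurable[OF h(1)] Y A(1) by auto
  define c where "c = (\<integral>x. indicat_real A x *\<^sub>R Y x \<partial>M) /\<^sub>R prob A"
  obtain p where p: "\<And>y. h c + p \<bullet> (y - c) \<le> h y"
    using convex_on_subgradient[OF h(1)] by blast
  have eq: "(\<integral>\<^sup>+x. ennreal (h (Y x)) * indicator A x \<partial>M) = (\<integral>\<^sup>+x. ennreal (indicator A x * h (Y x)) \<partial>M)"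
    by (intro nn_integral_cong) (auto simp: indicator_def)
  have int_h: "integrable M (\<lambda>x. indicat_real A x * h (Y x))"
    using False h(2) unfolding eq by (intro integrableI_nonneg) (auto simp: less_top)
  have int_Y: "integrable M (\<lambda>x. indicat_real A x *\<^sub>R Y x)"
    using Y A(1) by (intro integrable_mult_indicator) auto
  have int_1: "integrable M (indicat_real A)" "(\<integral>x. indicat_real A x \<partial>M) = prob A"
    using A(1) by (auto simp: emeasure_eq_measure)
  have "(\<integral>x. indicat_real A x *\<^sub>R Y x \<partial>M) = prob A *\<^sub>R c"
    using A(2) by (simp add: c_def)
  then have "prob A * h c = h c * prob A + (p \<bullet> (\<integral>x. indicat_real A x *\<^sub>R Y x \<partial>M) - (p \<bullet> c) * prob A)"
    by simp
  also have "\<dots> = (\<integral>x. h c * indicat_real A x + (p \<bullet> (indicat_real A x *\<^sub>R Y x) - (p \<bullet> c) * indicat_real A x) \<partial>M)"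
    using int_Y int_1 by (simp del: inner_scaleR_right)
  also have "\<dots> \<le> (\<integral>x. indicat_real A x * h (Y x) \<partial>M)"
  proof (intro integral_mono int_h)
    show "integrable M (\<lambda>x. h c * indicat_real A x + (p \<bullet> (indicat_real A x *\<^sub>R Y x) - (p \<bullet> c) * indicat_real A x))"
      using int_Y int_1 by (intro Bochner_Integration.integrable_add Bochner_Integration.integrable_diff)
        (auto simp del: inner_scaleR_right)
    show "h c * indicat_real A x + (p \<bullet> (indicat_real A x *\<^sub>R Y x) - (p \<bullet> c) * indicat_real A x)
        \<le> indicat_real A x * h (Y x)" for x
      using p[of "Y x"] by (auto simp: indicator_def inner_diff_right)
  qed
  finally have "ennreal (prob A * h c) \<le> ennreal (\<integral>x. indicat_real A x * h (Y x) \<partial>M)"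
    by (rule ennreal_leI)
  also have "\<dots> = (\<integral>\<^sup>+x. ennreal (h (Y x)) * indicator A x \<partial>M)"
    unfolding eq using int_h h(2) by (intro nn_integral_eq_integral[symmetric]) auto
  finally show ?thesis by (simp add: c_def)
qed simp

text \<open>Jensen under \<nu> with the whole space as the only cell. It guarantees that the infimum
  defining the nearest point runs over a nonempty set.\<close>

lemma (in prob_space) cx_dominated_const:
  assumes "\<nu> \<in> P2"
  shows "cx_dominated \<nu> M (\<lambda>_. mean \<nu>)"
proof -
  interpret n: prob_space \<nu> using assms by (rule P2_prob_space)
  have sp: "space \<nu> = UNIV" "UNIV \<in> n.events"
    using sets_eq_imp_space_eq[OF P2_sets[OF assms]] by (simp_all add: P2_sets[OF assms])
  have "ennreal (h (mean \<nu>)) \<le> (\<integral>\<^sup>+x. ennreal (h x) \<partial>\<nu>)"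
    if "convex_on UNIV h" "\<forall>x. 0 \<le> h x" for h
    using n.convex_conditional_mean_le[OF P2_integrable[OF assms], of "space \<nu>" h] that n.prob_space
    by (simp add: sp mean_def)
  then show ?thesis
    by (auto simp: cx_dominated_def nn_convex_order_def prob_space emeasure_space_1)
qed

text \<open>Convexity of the test function is used pointwise and then integrated. The combination is
  one of random variables on a common space, not a mixture of their laws; this is the convexity that
  a projection in the Hilbert space requires.\<close>

lemma (in prob_space) cx_dominated_convex:
  assumes \<nu>: "\<nu> \<in> P2" and Y: "cx_dominated \<nu> M Y" and Z: "cx_dominated \<nu> M Z"
    and t: "0 \<le> t" "t \<le> 1"
  shows "cx_dominated \<nu> M (\<lambda>x. (1 - t) *\<^sub>R Y x + t *\<^sub>R Z x)"
proof -
  have [measurable]: "Y \<in> borel_measurable M" "Z \<in> borel_measurable M"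
    using Y Z by (auto intro: cx_dominated_measurable)
  have "(\<integral>x. (1 - t) *\<^sub>R Y x + t *\<^sub>R Z x \<partial>M) = (1 - t) *\<^sub>R mean \<nu> + t *\<^sub>R mean \<nu>"
    using square_integrable_integrable[OF cx_dominated_square_integrable(1)[OF \<nu> Y]]
      square_integrable_integrable[OF cx_dominated_square_integrable(1)[OF \<nu> Z]]
    by (simp add: cx_dominated_mean[OF Y] cx_dominated_mean[OF Z])
  moreover have "(\<integral>\<^sup>+x. ennreal (h ((1 - t) *\<^sub>R Y x + t *\<^sub>R Z x)) \<partial>M) \<le> (\<integral>\<^sup>+x. ennreal (h x) \<partial>\<nu>)"
    if h: "convex_on UNIV h" "\<forall>x. 0 \<le> h x" for h
  proof -
    have [measurable]: "h \<in> borel_measurable borel" by (rule convex_on_borel_measurable[OF h(1)])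
    have "(\<integral>\<^sup>+x. ennreal (h ((1 - t) *\<^sub>R Y x + t *\<^sub>R Z x)) \<partial>M)
        \<le> (\<integral>\<^sup>+x. ennreal (1 - t) * ennreal (h (Y x)) + ennreal t * ennreal (h (Z x)) \<partial>M)"
    proof (intro nn_integral_mono)
      fix x
      have "ennreal (h ((1 - t) *\<^sub>R Y x + t *\<^sub>R Z x)) \<le> ennreal ((1 - t) * h (Y x) + t * h (Z x))"
        using convex_onD[OF h(1) t, of "Y x" "Z x"] by (intro ennreal_leI) auto
      then show "ennreal (h ((1 - t) *\<^sub>R Y x + t *\<^sub>R Z x))
          \<le> ennreal (1 - t) * ennreal (h (Y x)) + ennreal t * ennreal (h (Z x))"
        using t h(2) by (simp add: ennreal_plus ennreal_mult)
    qed
    also have "\<dots> = ennreal (1 - t) * (\<integral>\<^sup>+x. ennreal (h (Y x)) \<partial>M) + ennreal t * (\<integral>\<^sup>+x. ennreal (h (Z x)) \<partial>M)"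
      by (simp add: nn_integral_add nn_integral_cmult)
    also have "\<dots> \<le> ennreal (1 - t) * (\<integral>\<^sup>+x. ennreal (h x) \<partial>\<nu>) + ennreal t * (\<integral>\<^sup>+x. ennreal (h x) \<partial>\<nu>)"
      using h by (intro add_mono mult_left_mono cx_dominated_le[OF Y] cx_dominated_le[OF Z]) auto
    also have "\<dots> = (ennreal (1 - t) + ennreal t) * (\<integral>\<^sup>+x. ennreal (h x) \<partial>\<nu>)"
      by (simp add: distrib_right)
    also have "ennreal (1 - t) + ennreal t = 1"
      using t by (simp flip: ennreal_plus)
    finally show ?thesis by simp
  qed
  ultimately show ?thesis
    by (simp add: cx_dominated_def nn_convex_order_def flip: scaleR_add_left)
qed

section \<open>Closedness and existence of a nearest point\<close>

lemma nn_integral_le_liminf: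
  fixes u :: "nat \<Rightarrow> 'a \<Rightarrow> real"
  assumes [measurable]: "\<And>n. u n \<in> borel_measurable M"
    and lim: "AE x in M. (\<lambda>n. u n x) \<longlonglongrightarrow> v x"
  shows "(\<integral>\<^sup>+x. ennreal (v x) \<partial>M) \<le> liminf (\<lambda>n. \<integral>\<^sup>+x. ennreal (u n x) \<partial>M)"
proof -
  have "AE x in M. ennreal (v x) = liminf (\<lambda>n. ennreal (u n x))"
    using lim
  proof eventually_elim
    case (elim x)
    show ?case
      by (rule lim_imp_Liminf[symmetric, OF sequentially_bot tendsto_ennrealI[OF elim]])
  qed
  then have "(\<integral>\<^sup>+x. ennreal (v x) \<partial>M) = (\<integral>\<^sup>+x. liminf (\<lambda>n. ennreal (u n x)) \<partial>M)"
    by (rule nn_integral_cong_AE)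
  also have "\<dots> \<le> liminf (\<lambda>n. \<integral>\<^sup>+x. ennreal (u n x) \<partial>M)"
    by (rule nn_integral_liminf) measurable
  finally show ?thesis .
qed

text \<open>The inequalities pass to the limit by Fatou, since finite convex functions are
  continuous. Equality of the mean is not preserved by Fatou and rests on dominated convergence, for
  which \<open>w\<close> is the majorant.\<close>

lemma cx_dominated_limit:
  assumes Y: "\<And>n. cx_dominated \<nu> M (Y n)" and [measurable]: "T \<in> borel_measurable M"
    and lim: "AE x in M. (\<lambda>n. Y n x) \<longlonglongrightarrow> T x"
    and w: "integrable M w" "\<And>n. AE x in M. norm (Y n x) \<le> w x"
  shows "cx_dominated \<nu> M T"
proof -
  have [measurable]: "Y n \<in> borel_measurable M" for n by (rule cx_dominated_measurable[OF Y])
  have "(\<lambda>n. \<integral>x. Y n x \<partial>M) \<longlonglongrightarrow> (\<integral>x. T x \<partial>M)"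
    by (rule integral_dominated_convergence[OF _ _ w(1) lim w(2)]) measurable
  then have "(\<integral>x. T x \<partial>M) = mean \<nu>"
    by (simp add: cx_dominated_mean[OF Y] LIMSEQ_const_iff)
  moreover have "(\<integral>\<^sup>+x. ennreal (h (T x)) \<partial>M) \<le> (\<integral>\<^sup>+x. ennreal (h x) \<partial>\<nu>)"
    if h: "convex_on UNIV h" "\<forall>x. 0 \<le> h x" for h
  proof -
    have [measurable]: "h \<in> borel_measurable borel" by (rule convex_on_borel_measurable[OF h(1)])
    have cont: "continuous_on UNIV h" using h(1) by (intro convex_on_continuous) auto
    have "(\<integral>\<^sup>+x. ennreal (h (T x)) \<partial>M) \<le> liminf (\<lambda>n. \<integral>\<^sup>+x. ennreal (h (Y n x)) \<partial>M)"
      using lim by (intro nn_integral_le_liminf) (auto elim!: eventually_mono intro!: continuous_on_tendsto_compose[OF cont])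
    also have "\<dots> \<le> (\<integral>\<^sup>+x. ennreal (h x) \<partial>\<nu>)"
      using cx_dominated_le[OF Y h(1)] h(2) by (intro Liminf_le) (auto intro: always_eventually)
    finally show ?thesis .
  qed
  ultimately show ?thesis by (simp add: cx_dominated_def nn_convex_order_def)
qed

text \<open>This is the usual proof that the space of square integrable maps is complete: the
  increments have summable first moments, so their series converges absolutely almost everywhere.
  The majorant is the norm of \<open>Y 0\<close> plus the sum of all increment norms.\<close>

lemma (in prob_space) AE_convergent_if_summable_square_steps:
  fixes Y :: "nat \<Rightarrow> 'a \<Rightarrow> 'b::euclidean_space"
  assumes Y: "\<And>n. square_integrable M (Y n)"
    and step: "\<And>n. (\<integral>x. (norm (Y (Suc n) x - Y n x))\<^sup>2 \<partial>M) \<le> C * (1/4) ^ n"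
  obtains w where "integrable M w" "\<And>n. AE x in M. norm (Y n x) \<le> w x"
    "AE x in M. convergent (\<lambda>n. Y n x)"
proof -
  have [measurable]: "Y n \<in> borel_measurable M" for n by (rule square_integrable_measurable[OF Y])
  define \<Delta> where "\<Delta> n x = norm (Y (Suc n) x - Y n x)" for n x
  have [measurable]: "\<Delta> n \<in> borel_measurable M" for n unfolding \<Delta>_def by measurable
  have sq: "square_integrable M (\<lambda>x. Y (Suc n) x - Y n x)" for n
    by (intro square_integrable_diff Y)
  have int_\<Delta>: "integrable M (\<Delta> n)" for n
    unfolding \<Delta>_def by (intro integrable_norm square_integrable_integrable sq)
  have int_\<Delta>2: "integrable M (\<lambda>x. (\<Delta> n x)\<^sup>2)" for n
    unfolding \<Delta>_def by (intro square_integrable_norm sq)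
  have bound: "(\<integral>x. \<Delta> n x \<partial>M) \<le> (C + 1) * (1/2) ^ n" for n
  proof -
    \<comment> \<open>The inequality \<open>a \<le> a\<^sup>2 + 1\<close> at
      \<open>a = 2 ^ n * \<Delta> n x\<close>, divided by \<open>2 ^ n\<close>. This weight balances
      the assumed decay: both resulting terms are of order \<open>(1/2) ^ n\<close>.\<close>
    have "(\<integral>x. \<Delta> n x \<partial>M) \<le> (\<integral>x. 2 ^ n * (\<Delta> n x)\<^sup>2 + (1/2) ^ n \<partial>M)"
    proof (intro integral_mono int_\<Delta>)
      fix x
      define a where "a = 2 ^ n * \<Delta> n x"
      have "(1/2) ^ n * 2 ^ n = (1/2 * 2 :: real) ^ n"
        by (rule power_mult_distrib[symmetric])
      then have "(1/2) ^ n * (2 ^ n * b) = b" for b :: real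
        unfolding mult.assoc[symmetric] by simp
      then have "(1/2) ^ n * a = \<Delta> n x" "(1/2) ^ n * a\<^sup>2 = 2 ^ n * (\<Delta> n x)\<^sup>2"
        unfolding a_def power2_eq_square mult.assoc by (simp_all only: mult.left_commute)
      moreover have "a \<le> a\<^sup>2 + 1"
        using sum_squares_bound[of 1 a] zero_le_power2[of a] unfolding one_power2 by linarith
      then have "(1/2) ^ n * a \<le> (1/2) ^ n * (a\<^sup>2 + 1)"
        by (intro mult_left_mono) auto
      ultimately show "\<Delta> n x \<le> 2 ^ n * (\<Delta> n x)\<^sup>2 + (1/2) ^ n"
        by (simp only: distrib_left mult_1_right)
    qed (use int_\<Delta>2 in auto)
    also have "\<dots> = 2 ^ n * (\<integral>x. (\<Delta> n x)\<^sup>2 \<partial>M) + (1/2) ^ n"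
      using int_\<Delta>2 by (simp add: prob_space)
    also have "\<dots> \<le> 2 ^ n * (C * (1/4) ^ n) + (1/2) ^ n"
      using step[of n] by (intro add_right_mono mult_left_mono) (auto simp: \<Delta>_def)
    also have "\<dots> = (C + 1) * (1/2) ^ n"
    proof -
      have "2 ^ n * (1/4) ^ n = (2 * (1/4) :: real) ^ n"
        by (rule power_mult_distrib[symmetric])
      then have "2 ^ n * (C * (1/4) ^ n) = C * (1/2) ^ n"
        by (simp only: mult.left_commute) simp
      then show ?thesis by (simp only: distrib_right mult_1_left)
    qed
    finally show ?thesis .
  qed
  have fin: "(\<integral>\<^sup>+x. (\<Sum>n. ennreal (\<Delta> n x)) \<partial>M) \<noteq> \<infinity>"
  proof -
    have "summable (\<lambda>n. (\<integral>x. \<Delta> n x \<partial>M))"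
    proof (rule summable_comparison_test'[where N = 0])
      show "summable (\<lambda>n. (C + 1) * (1/2::real) ^ n)" by (intro summable_mult summable_geometric) auto
      show "norm (\<integral>x. \<Delta> n x \<partial>M) \<le> (C + 1) * (1/2) ^ n" for n
        using bound[of n] Bochner_Integration.integral_nonneg[of M "\<Delta> n"] by (simp add: \<Delta>_def)
    qed
    then have "(\<Sum>n. ennreal (\<integral>x. \<Delta> n x \<partial>M)) \<noteq> \<infinity>"
      unfolding infinity_ennreal_def
      by (rule ennreal_suminf_neq_top) (auto simp: \<Delta>_def intro!: Bochner_Integration.integral_nonneg)
    moreover have "(\<integral>\<^sup>+x. ennreal (\<Delta> n x) \<partial>M) = ennreal (\<integral>x. \<Delta> n x \<partial>M)" for n
      by (intro nn_integral_eq_integral int_\<Delta>) (auto simp: \<Delta>_def)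
    ultimately show ?thesis by (subst nn_integral_suminf) auto
  qed
  have sm: "AE x in M. summable (\<lambda>n. \<Delta> n x)"
  proof -
    have "AE x in M. (\<Sum>n. ennreal (\<Delta> n x)) \<noteq> \<infinity>"
      by (rule nn_integral_PInf_AE[OF _ fin]) measurable
    then show ?thesis
    proof eventually_elim
      case (elim x)
      show ?case
        by (rule summable_suminf_not_top) (use elim in \<open>simp_all add: \<Delta>_def\<close>)
    qed
  qed
  define w where "w x = norm (Y 0 x) + (\<Sum>n. \<Delta> n x)" for x
  show thesis
  proof
    have "(\<integral>\<^sup>+x. ennreal (\<Sum>n. \<Delta> n x) \<partial>M) = (\<integral>\<^sup>+x. (\<Sum>n. ennreal (\<Delta> n x)) \<partial>M)"
      using sm by (intro nn_integral_cong_AE) (auto elim!: eventually_mono intro!: suminf_ennreal2[symmetric] simp: \<Delta>_def)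
    moreover have "AE x in M. 0 \<le> (\<Sum>n. \<Delta> n x)"
      using sm by (auto elim!: eventually_mono intro!: suminf_nonneg simp: \<Delta>_def)
    ultimately have "integrable M (\<lambda>x. \<Sum>n. \<Delta> n x)"
      using fin by (intro integrableI_nonneg) (auto simp: less_top)
    then show "integrable M w"
      unfolding w_def by (intro Bochner_Integration.integrable_add integrable_norm square_integrable_integrable[OF Y])
    have tel: "Y n x = Y 0 x + (\<Sum>i<n. Y (Suc i) x - Y i x)" for n x
      using sum_lessThan_telescope[of "\<lambda>i. Y i x" n] by simp
    show "AE x in M. norm (Y n x) \<le> w x" for n
      using sm
    proof eventually_elim
      case (elim x)
      have "norm (Y n x) \<le> norm (Y 0 x) + norm (\<Sum>i<n. Y (Suc i) x - Y i x)"
        by (subst tel) (rule norm_triangle_ineq)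
      also have "norm (\<Sum>i<n. Y (Suc i) x - Y i x) \<le> (\<Sum>i<n. \<Delta> i x)"
        unfolding \<Delta>_def by (rule norm_sum)
      also have "\<dots> \<le> (\<Sum>i. \<Delta> i x)"
        using elim by (intro sum_le_suminf) (auto simp: \<Delta>_def)
      finally show ?case by (simp add: w_def)
    qed
    show "AE x in M. convergent (\<lambda>n. Y n x)"
      using sm
    proof eventually_elim
      case (elim x)
      then have "summable (\<lambda>n. Y (Suc n) x - Y n x)"
        unfolding \<Delta>_def by (rule summable_norm_cancel)
      then have "convergent (\<lambda>n. \<Sum>i<n. Y (Suc i) x - Y i x)"
        by (simp add: summable_iff_convergent)
      then have "convergent (\<lambda>n. Y 0 x + (\<Sum>i<n. Y (Suc i) x - Y i x))"
        by (intro convergent_add convergent_const)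
      also have "(\<lambda>n. Y 0 x + (\<Sum>i<n. Y (Suc i) x - Y i x)) = (\<lambda>n. Y n x)"
        by (intro ext tel[symmetric])
      finally show ?case .
    qed
  qed
qed

text \<open>Projection onto a closed convex set: the parallelogram identity makes a fast minimizing
  sequence converge, and Fatou shows that its limit attains the infimum.\<close>

lemma (in prob_space) cx_dominated_nearest_exists:
  assumes \<nu>: "\<nu> \<in> P2" and X: "square_integrable M X"
  obtains T where "cx_dominated \<nu> M T"
    "\<And>S. cx_dominated \<nu> M S \<Longrightarrow> (\<integral>x. (norm (X x - T x))\<^sup>2 \<partial>M) \<le> (\<integral>x. (norm (X x - S x))\<^sup>2 \<partial>M)"
proof -
  define D where "D S = (\<integral>x. (norm (X x - S x))\<^sup>2 \<partial>M)" for S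
  define d where "d = (INF S\<in>Collect (cx_dominated \<nu> M). D S)"
  note sq = cx_dominated_square_integrable(1)[OF \<nu>]
  have ne: "Collect (cx_dominated \<nu> M) \<noteq> {}" using cx_dominated_const[OF \<nu>] by auto
  have bdd: "bdd_below (D ` Collect (cx_dominated \<nu> M))"
    by (intro bdd_belowI[of _ 0]) (auto simp: D_def)
  have d_le: "d \<le> D S" if "cx_dominated \<nu> M S" for S
    unfolding d_def using that by (intro cINF_lower bdd) auto
  \<comment> \<open>The defect \<open>(1/4) ^ n\<close> passes through the parallelogram identity to
    the squared steps, giving the rate demanded by the convergence lemma.\<close>
  have "\<exists>S. cx_dominated \<nu> M S \<and> D S < d + (1/4) ^ n" for n :: nat
    using cInf_lessD[of "D ` Collect (cx_dominated \<nu> M)" "d + (1/4) ^ n"] ne by (auto simp: d_def)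
  then obtain Y where Y: "\<And>n. cx_dominated \<nu> M (Y n)" and DY: "\<And>n. D (Y n) < d + (1/4) ^ n"
    by metis
  have [measurable]: "X \<in> borel_measurable M" "Y n \<in> borel_measurable M" for n
    using X Y by (auto intro: square_integrable_measurable cx_dominated_measurable)
  have int: "integrable M (\<lambda>x. (norm (X x - S x))\<^sup>2)" if "cx_dominated \<nu> M S" for S
    by (intro square_integrable_norm square_integrable_diff X sq that)
  have "(\<integral>x. (norm (Y (Suc n) x - Y n x))\<^sup>2 \<partial>M) \<le> 4 * (1/4) ^ n" for n
  proof -
    \<comment> \<open>The midpoint is again dominated, so its distance functional is at least
      \<open>d\<close>. In the parallelogram identity all terms in \<open>d\<close> cancel and only
      the two defects remain.\<close>
    define Z where "Z x = (1 - 1/2) *\<^sub>R Y n x + (1/2) *\<^sub>R Y (Suc n) x" for x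
    have Z: "cx_dominated \<nu> M Z"
      unfolding Z_def by (intro cx_dominated_convex \<nu> Y) auto
    have "(norm (Y (Suc n) x - Y n x))\<^sup>2
        = 2 * (norm (X x - Y (Suc n) x))\<^sup>2 + 2 * (norm (X x - Y n x))\<^sup>2 - 4 * (norm (X x - Z x))\<^sup>2" for x
      by (simp add: Z_def power2_norm_eq_inner inner_simps inner_commute algebra_simps)
    then have "(\<integral>x. (norm (Y (Suc n) x - Y n x))\<^sup>2 \<partial>M) = 2 * D (Y (Suc n)) + 2 * D (Y n) - 4 * D Z"
      using int[OF Y] int[OF Z] by (simp add: D_def)
    also have "\<dots> \<le> 2 * (1/4) ^ Suc n + 2 * (1/4) ^ n"
      using DY[of n] DY[of "Suc n"] d_le[OF Z] by linarith
    also have "\<dots> \<le> 4 * (1/4) ^ n" by simp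
    finally show ?thesis .
  qed
  then obtain w where w: "integrable M w" "\<And>n. AE x in M. norm (Y n x) \<le> w x"
    and conv: "AE x in M. convergent (\<lambda>n. Y n x)"
    using AE_convergent_if_summable_square_steps[of Y 4] sq[OF Y] by blast
  define T where "T x = lim (\<lambda>n. Y n x)" for x
  have lim: "AE x in M. (\<lambda>n. Y n x) \<longlonglongrightarrow> T x"
    using conv by (auto elim!: eventually_mono simp: T_def convergent_LIMSEQ_iff)
  have [measurable]: "T \<in> borel_measurable M" unfolding T_def by measurable
  have T: "cx_dominated \<nu> M T"
    by (rule cx_dominated_limit[OF Y _ lim w]) measurable
  have "(\<lambda>n. D (Y n)) \<longlonglongrightarrow> d"
  proof (rule tendsto_sandwich[where f = "\<lambda>_. d" and h = "\<lambda>n. d + (1/4) ^ n"])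
    have "(\<lambda>n. d + (1/4) ^ n) \<longlonglongrightarrow> d + 0"
      by (intro tendsto_intros LIMSEQ_power_zero) auto
    then show "(\<lambda>n. d + (1/4) ^ n) \<longlonglongrightarrow> d" by simp
  qed (use d_le[OF Y] less_imp_le[OF DY] in auto)
  then have lim_D: "liminf (\<lambda>n. ennreal (D (Y n))) = ennreal d"
    by (intro lim_imp_Liminf tendsto_ennrealI) auto
  have nn: "(\<integral>\<^sup>+x. ennreal ((norm (X x - S x))\<^sup>2) \<partial>M) = ennreal (D S)" if "cx_dominated \<nu> M S" for S
    unfolding D_def by (intro nn_integral_eq_integral int that) auto
  have "(\<integral>\<^sup>+x. ennreal ((norm (X x - T x))\<^sup>2) \<partial>M) \<le> liminf (\<lambda>n. \<integral>\<^sup>+x. ennreal ((norm (X x - Y n x))\<^sup>2) \<partial>M)"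
    using lim by (intro nn_integral_le_liminf) (auto elim!: eventually_mono intro!: tendsto_intros)
  then have "ennreal (D T) \<le> ennreal d"
    by (simp add: nn[OF T] nn[OF Y] lim_D)
  moreover have "0 \<le> d"
    unfolding d_def using ne by (intro cINF_greatest) (auto simp: D_def)
  ultimately have "D T \<le> d" by simp
  with T d_le show thesis
    by (intro that[of T]) (auto simp: D_def intro: order_trans)
qed

section \<open>The variational inequality\<close>

text \<open>Division by \<open>t\<close> and a small \<open>t\<close> suffice. The explicit choice
  makes \<open>t * b\<close> at most \<open>a\<close>, so a positive \<open>a\<close> would satisfy
  \<open>2 * a \<le> a\<close>.\<close>

lemma nonpos_if_linear_le_quadratic:
  fixes a b :: real
  assumes "\<And>t. 0 < t \<Longrightarrow> t \<le> 1 \<Longrightarrow> 2 * t * a \<le> t\<^sup>2 * b"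
  shows "a \<le> 0"
proof (rule ccontr)
  assume "\<not> a \<le> 0"
  define t where "t = min 1 (a / (\<bar>b\<bar> + 1))"
  have t: "0 < t" "t \<le> 1" "t \<le> a / (\<bar>b\<bar> + 1)"
    using \<open>\<not> a \<le> 0\<close> by (auto simp: t_def)
  have "t * (2 * a) \<le> t * (t * b)"
    using assms[OF t(1,2)] by (simp add: power2_eq_square mult.assoc mult.left_commute)
  then have "2 * a \<le> t * b" using t(1) by simp
  also have "\<dots> \<le> t * (\<bar>b\<bar> + 1)" using t(1) by (intro mult_left_mono) auto
  also have "\<dots> \<le> a" using t(3) by (simp add: pos_le_divide_eq)
  finally show False using \<open>\<not> a \<le> 0\<close> by simp
qed

text \<open>\<open>T\<close> is compared with the points at parameter \<open>t\<close> on the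
  segment towards \<open>S\<close>. The expansion of the squared distance is quadratic in
  \<open>t\<close>, and minimality at \<open>t = 0\<close> fixes the sign of the linear
  coefficient.\<close>

lemma (in prob_space) cx_dominated_nearest_obtuse:
  assumes \<nu>: "\<nu> \<in> P2" and X: "square_integrable M X" and T: "cx_dominated \<nu> M T"
    and nearest: "\<And>S. cx_dominated \<nu> M S \<Longrightarrow>
      (\<integral>x. (norm (X x - T x))\<^sup>2 \<partial>M) \<le> (\<integral>x. (norm (X x - S x))\<^sup>2 \<partial>M)"
    and S: "cx_dominated \<nu> M S"
  shows "(\<integral>x. (X x - T x) \<bullet> (S x - T x) \<partial>M) \<le> 0"
proof (rule nonpos_if_linear_le_quadratic)
  fix t :: real assume t: "0 < t" "t \<le> 1"
  note sq = cx_dominated_square_integrable(1)[OF \<nu>]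
  have "(norm (X x - ((1 - t) *\<^sub>R T x + t *\<^sub>R S x)))\<^sup>2 = (norm (X x - T x))\<^sup>2
      - 2 * t * ((X x - T x) \<bullet> (S x - T x)) + t\<^sup>2 * (norm (S x - T x))\<^sup>2" for x
  proof -
    have "X x - ((1 - t) *\<^sub>R T x + t *\<^sub>R S x) = (X x - T x) + (- t) *\<^sub>R (S x - T x)"
      by (simp add: algebra_simps)
    then show ?thesis by (simp only: norm_add_scaleR_power2) simp
  qed
  then have "(\<integral>x. (norm (X x - T x))\<^sup>2 \<partial>M) \<le> (\<integral>x. (norm (X x - T x))\<^sup>2
      - 2 * t * ((X x - T x) \<bullet> (S x - T x)) + t\<^sup>2 * (norm (S x - T x))\<^sup>2 \<partial>M)"
    using nearest[OF cx_dominated_convex[OF \<nu> T S, of t]] t by simp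
  also have "\<dots> = (\<integral>x. (norm (X x - T x))\<^sup>2 \<partial>M) - 2 * t * (\<integral>x. (X x - T x) \<bullet> (S x - T x) \<partial>M)
      + t\<^sup>2 * (\<integral>x. (norm (S x - T x))\<^sup>2 \<partial>M)"
    using square_integrable_norm[OF square_integrable_diff[OF X sq[OF T]]]
      square_integrable_norm[OF square_integrable_diff[OF sq[OF S] sq[OF T]]]
      square_integrable_inner[OF square_integrable_diff[OF X sq[OF T]] square_integrable_diff[OF sq[OF S] sq[OF T]]]
    by simp
  finally show "2 * t * (\<integral>x. (X x - T x) \<bullet> (S x - T x) \<partial>M) \<le> t\<^sup>2 * (\<integral>x. (norm (S x - T x))\<^sup>2 \<partial>M)"
    by simp
qed

section \<open>The projection under a coupling\<close>

text \<open>Conditional expectation given a simple function needs no more than finitely many cells, and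
  every square integrable function is a limit of simple ones; this replaces the conditional
  expectation given a general random variable.\<close>

lemma (in prob_space) cx_dominated_conditional_mean:
  fixes G :: "'a \<Rightarrow> 'b::euclidean_space" and Y :: "'a \<Rightarrow> 'b"
  assumes \<nu>: "\<nu> \<in> P2" and Y: "cx_dominated \<nu> M Y" and G: "simple_function M G"
  obtains c where "cx_dominated \<nu> M (\<lambda>\<omega>. c (G \<omega>))"
    "(\<integral>\<omega>. G \<omega> \<bullet> Y \<omega> \<partial>M) = (\<integral>\<omega>. G \<omega> \<bullet> c (G \<omega>) \<partial>M)"
proof -
  define V where "V = G ` space M"
  define A where "A v = G -` {v} \<inter> space M" for v
  define c where "c v = (\<integral>\<omega>. indicat_real (A v) \<omega> *\<^sub>R Y \<omega> \<partial>M) /\<^sub>R prob (A v)" for v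
  have V: "finite V" using G by (auto simp: V_def simple_function_def)
  have A[measurable]: "A v \<in> events" for v
    unfolding A_def using G by (rule simple_functionD)
  have [measurable]: "Y \<in> borel_measurable M" using Y by (rule cx_dominated_measurable)
  have int_Y: "integrable M Y"
    using cx_dominated_square_integrable(1)[OF \<nu> Y] by (rule square_integrable_integrable)
  have int_AY: "integrable M (\<lambda>\<omega>. indicat_real (A v) \<omega> *\<^sub>R Y \<omega>)" for v
    using int_Y A by (intro integrable_mult_indicator) auto
  \<comment> \<open>Exactly one cell contains \<omega>. \<open>F\<close> depends on both the cell
    value and \<omega>, so the same identity serves for \<open>c\<close>, for \<open>Y\<close> and
    for the inner products below.\<close>
  have split: "F (G \<omega>) \<omega> = (\<Sum>v\<in>V. indicat_real (A v) \<omega> *\<^sub>R F v \<omega>)"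
    if "\<omega> \<in> space M" for F :: "'b \<Rightarrow> 'a \<Rightarrow> 'c::real_vector" and \<omega>
  proof -
    have "(\<Sum>v\<in>V. indicat_real (A v) \<omega> *\<^sub>R F v \<omega>) = (\<Sum>v\<in>V. if G \<omega> = v then F v \<omega> else 0)"
      using that by (intro sum.cong) (auto simp: A_def)
    also have "\<dots> = F (G \<omega>) \<omega>"
      using V that by (simp add: V_def)
    finally show ?thesis ..
  qed
  have split_nn: "f \<omega> = (\<Sum>v\<in>V. f \<omega> * indicator (A v) \<omega>)" if "\<omega> \<in> space M" for f :: "'a \<Rightarrow> ennreal" and \<omega>
  proof -
    have "(\<Sum>v\<in>V. f \<omega> * indicator (A v) \<omega>) = (\<Sum>v\<in>V. if G \<omega> = v then f \<omega> else 0)"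
      using that by (intro sum.cong) (auto simp: A_def)
    also have "\<dots> = f \<omega>"
      using V that by (simp add: V_def)
    finally show ?thesis ..
  qed
  \<comment> \<open>On a null cell \<open>c v\<close> is 0 because inversion of 0 gives 0, and the
    integral over the cell vanishes as well; the identity thus holds for every
    \<open>v\<close>.\<close>
  have pc: "prob (A v) *\<^sub>R c v = (\<integral>\<omega>. indicat_real (A v) \<omega> *\<^sub>R Y \<omega> \<partial>M)" for v
  proof (cases "prob (A v) = 0")
    case True
    then have "AE \<omega> in M. \<omega> \<notin> A v"
      using A by (intro AE_not_in) (auto simp: null_sets_def emeasure_eq_measure)
    then have "(\<integral>\<omega>. indicat_real (A v) \<omega> *\<^sub>R Y \<omega> \<partial>M) = (\<integral>\<omega>. 0 \<partial>M)"
      by (intro integral_cong_AE) (auto elim!: eventually_mono)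
    with True show ?thesis by simp
  qed (simp add: c_def)
  have cG: "simple_function M (\<lambda>\<omega>. c (G \<omega>))"
    using simple_function_compose[OF G, of c] by (simp add: comp_def)
  have "(\<integral>\<omega>. c (G \<omega>) \<partial>M) = (\<integral>\<omega>. (\<Sum>v\<in>V. indicat_real (A v) \<omega> *\<^sub>R c v) \<partial>M)"
    by (intro Bochner_Integration.integral_cong refl split[of _ "\<lambda>v \<omega>. c v"])
  also have "\<dots> = (\<Sum>v\<in>V. prob (A v) *\<^sub>R c v)"
    by (simp add: Bochner_Integration.integral_sum emeasure_eq_measure)
  also have "\<dots> = (\<integral>\<omega>. (\<Sum>v\<in>V. indicat_real (A v) \<omega> *\<^sub>R Y \<omega>) \<partial>M)"
    using int_AY by (simp add: Bochner_Integration.integral_sum pc)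
  also have "\<dots> = (\<integral>\<omega>. Y \<omega> \<partial>M)"
    by (intro Bochner_Integration.integral_cong refl split[of _ "\<lambda>v. Y", symmetric])
  also have "\<dots> = mean \<nu>" by (rule cx_dominated_mean[OF Y])
  finally have mean: "(\<integral>\<omega>. c (G \<omega>) \<partial>M) = mean \<nu>" .
  have "(\<integral>\<^sup>+\<omega>. ennreal (h (c (G \<omega>))) \<partial>M) \<le> (\<integral>\<^sup>+x. ennreal (h x) \<partial>\<nu>)"
    if h: "convex_on UNIV h" "\<forall>x. 0 \<le> h x" for h
  proof -
    have [measurable]: "h \<in> borel_measurable borel" by (rule convex_on_borel_measurable[OF h(1)])
    have "(\<integral>\<^sup>+\<omega>. ennreal (h (c (G \<omega>))) \<partial>M) = (\<integral>\<^sup>+\<omega>. (\<Sum>v\<in>V. ennreal (h (c v)) * indicator (A v) \<omega>) \<partial>M)"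
    proof (intro nn_integral_cong)
      fix \<omega> assume \<omega>: "\<omega> \<in> space M"
      have "ennreal (h (c (G \<omega>))) = (\<Sum>v\<in>V. ennreal (h (c (G \<omega>))) * indicator (A v) \<omega>)"
        by (rule split_nn[OF \<omega>])
      also have "\<dots> = (\<Sum>v\<in>V. ennreal (h (c v)) * indicator (A v) \<omega>)"
        by (intro sum.cong) (auto simp: A_def indicator_def)
      finally show "ennreal (h (c (G \<omega>))) = (\<Sum>v\<in>V. ennreal (h (c v)) * indicator (A v) \<omega>)" .
    qed
    also have "\<dots> = (\<Sum>v\<in>V. ennreal (h (c v)) * emeasure M (A v))"
      by (subst nn_integral_sum) (auto simp: nn_integral_cmult_indicator)
    also have "\<dots> \<le> (\<Sum>v\<in>V. \<integral>\<^sup>+\<omega>. ennreal (h (Y \<omega>)) * indicator (A v) \<omega> \<partial>M)"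
    proof (intro sum_mono)
      fix v
      show "ennreal (h (c v)) * emeasure M (A v) \<le> (\<integral>\<^sup>+\<omega>. ennreal (h (Y \<omega>)) * indicator (A v) \<omega> \<partial>M)"
      proof (cases "prob (A v) = 0")
        case False
        then have "ennreal (prob (A v) * h (c v)) \<le> (\<integral>\<^sup>+\<omega>. ennreal (h (Y \<omega>)) * indicator (A v) \<omega> \<partial>M)"
          unfolding c_def using h(2) by (intro convex_conditional_mean_le int_Y A h(1)) (auto simp: zero_less_measure_iff)
        then show ?thesis
          using h(2) by (simp add: emeasure_eq_measure ennreal_mult mult.commute)
      qed (simp add: emeasure_eq_measure)
    qed
    also have "\<dots> = (\<integral>\<^sup>+\<omega>. (\<Sum>v\<in>V. ennreal (h (Y \<omega>)) * indicator (A v) \<omega>) \<partial>M)"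
      by (subst nn_integral_sum) auto
    also have "\<dots> = (\<integral>\<^sup>+\<omega>. ennreal (h (Y \<omega>)) \<partial>M)"
      by (intro nn_integral_cong split_nn[symmetric])
    also have "\<dots> \<le> (\<integral>\<^sup>+x. ennreal (h x) \<partial>\<nu>)"
      using h by (intro cx_dominated_le[OF Y]) auto
    finally show ?thesis .
  qed
  then have dom: "cx_dominated \<nu> M (\<lambda>\<omega>. c (G \<omega>))"
    using mean borel_measurable_simple_function[OF cG] by (simp add: cx_dominated_def nn_convex_order_def)
  \<comment> \<open>\<open>G\<close> equals \<open>v\<close> on its cell, so the inner product sees
    only the integral of \<open>Y\<close> over that cell, and \<open>c v\<close> reproduces this
    integral.\<close>
  have "(\<integral>\<omega>. G \<omega> \<bullet> Y \<omega> \<partial>M) = (\<integral>\<omega>. (\<Sum>v\<in>V. indicat_real (A v) \<omega> *\<^sub>R (v \<bullet> Y \<omega>)) \<partial>M)"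
    by (intro Bochner_Integration.integral_cong refl split[of _ "\<lambda>v \<omega>. v \<bullet> Y \<omega>"])
  also have "\<dots> = (\<integral>\<omega>. (\<Sum>v\<in>V. v \<bullet> (indicat_real (A v) \<omega> *\<^sub>R Y \<omega>)) \<partial>M)"
    by simp
  also have "\<dots> = (\<Sum>v\<in>V. v \<bullet> (\<integral>\<omega>. indicat_real (A v) \<omega> *\<^sub>R Y \<omega> \<partial>M))"
    using int_AY by (subst Bochner_Integration.integral_sum)
      (auto simp del: inner_scaleR_right intro!: integrable_inner_right sum.cong integral_inner_right)
  also have "\<dots> = (\<Sum>v\<in>V. prob (A v) * (v \<bullet> c v))"
    by (simp flip: pc)
  also have "\<dots> = (\<integral>\<omega>. (\<Sum>v\<in>V. indicat_real (A v) \<omega> *\<^sub>R (v \<bullet> c v)) \<partial>M)"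
    by (simp add: Bochner_Integration.integral_sum emeasure_eq_measure)
  also have "\<dots> = (\<integral>\<omega>. G \<omega> \<bullet> c (G \<omega>) \<partial>M)"
    by (intro Bochner_Integration.integral_cong refl split[of _ "\<lambda>v \<omega>. v \<bullet> c v", symmetric])
  finally show thesis using dom by (rule that[rotated])
qed

lemma cx_dominated_distr:
  assumes [measurable]: "X \<in> M \<rightarrow>\<^sub>M N" and S[measurable]: "S \<in> borel_measurable N"
  shows "cx_dominated \<nu> (distr M N X) S \<longleftrightarrow> cx_dominated \<nu> M (\<lambda>x. S (X x))"
proof -
  have "(\<integral>\<^sup>+x. ennreal (h (S x)) \<partial>distr M N X) = (\<integral>\<^sup>+x. ennreal (h (S (X x))) \<partial>M)"
    if "convex_on UNIV h" for h
  proof -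
    have [measurable]: "h \<in> borel_measurable borel" by (rule convex_on_borel_measurable[OF that])
    show ?thesis by (rule nn_integral_distr) measurable
  qed
  moreover have "(\<integral>x. S x \<partial>distr M N X) = (\<integral>x. S (X x) \<partial>M)"
    by (rule integral_distr) measurable
  moreover have "(\<lambda>x. S (X x)) \<in> borel_measurable M" by measurable
  ultimately show ?thesis
    using S by (simp add: cx_dominated_def nn_convex_order_def)
qed

lemma square_integrable_distr:
  assumes [measurable]: "X \<in> M \<rightarrow>\<^sub>M N" and S[measurable]: "S \<in> borel_measurable N"
  shows "square_integrable (distr M N X) S \<longleftrightarrow> square_integrable M (\<lambda>x. S (X x))"
  using S measurable_comp[OF assms] by (simp add: square_integrable_def integrable_distr_eq comp_def)

lemma le_if_le_add_scaled:
  fixes a b B :: real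
  assumes "\<And>\<epsilon>. 0 < \<epsilon> \<Longrightarrow> a \<le> b + \<epsilon> * B" and "0 \<le> B"
  shows "a \<le> b"
proof (rule field_le_epsilon)
  fix e :: real assume e: "0 < e"
  have "a \<le> b + e / (B + 1) * B"
    using e assms(2) by (intro assms(1)) auto
  also have "e / (B + 1) * B \<le> e"
    using e assms(2) by (simp add: field_simps)
  finally show "a \<le> b + e" by simp
qed

text \<open>Expansion of the squared norm of \<open>a - e *\<^sub>R b\<close>, divided by
  \<open>e\<close>. The sharp factor 1/2 is given away.\<close>

lemma inner_le_young:
  fixes a b :: "'a::real_inner"
  assumes "0 < e"
  shows "a \<bullet> b \<le> (norm a)\<^sup>2 / e + e * (norm b)\<^sup>2"
proof -
  have "0 \<le> (norm a)\<^sup>2 + 2 * (- e) * (a \<bullet> b) + (- e)\<^sup>2 * (norm b)\<^sup>2"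
    unfolding norm_add_scaleR_power2[symmetric] by simp
  then have "2 * e * (a \<bullet> b) \<le> (norm a)\<^sup>2 + e\<^sup>2 * (norm b)\<^sup>2"
    by simp
  then have "2 * (a \<bullet> b) \<le> (norm a)\<^sup>2 / e + e * (norm b)\<^sup>2"
    using assms by (simp add: field_simps power2_eq_square)
  moreover have "0 \<le> (norm a)\<^sup>2 / e + e * (norm b)\<^sup>2" using assms by simp
  ultimately show ?thesis by linarith
qed

text \<open>This extends the variational inequality from functions of \<open>X\<close> to every
  dominated \<open>Y\<close> on the same space. With the residual \<open>g\<close> replaced by a
  simple \<open>F i\<close>, the variable \<open>Y\<close> may be exchanged for its conditional mean
  on the cells of \<open>F i (X \<omega>)\<close>. That mean is a dominated function of
  \<open>X\<close>, so the inequality under the law of \<open>X\<close> applies to it.\<close>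

lemma (in prob_space) cx_dominated_nearest_obtuse_coupled:
  fixes X :: "'a \<Rightarrow> 'b::euclidean_space"
  assumes \<nu>: "\<nu> \<in> P2" and X: "square_integrable M X"
    and T: "cx_dominated \<nu> (distr M borel X) T"
    and nearest: "\<And>S. cx_dominated \<nu> (distr M borel X) S \<Longrightarrow>
      (\<integral>x. (norm (x - T x))\<^sup>2 \<partial>distr M borel X) \<le> (\<integral>x. (norm (x - S x))\<^sup>2 \<partial>distr M borel X)"
    and Y: "cx_dominated \<nu> M Y"
  shows "(\<integral>\<omega>. (X \<omega> - T (X \<omega>)) \<bullet> (Y \<omega> - T (X \<omega>)) \<partial>M) \<le> 0"
proof -
  note sq = cx_dominated_square_integrable(1)[OF \<nu>]
  have X_meas[measurable]: "X \<in> borel_measurable M" using X by (rule square_integrable_measurable)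
  have T_meas[measurable]: "T \<in> borel_measurable borel"
    using cx_dominated_measurable[OF T] by simp
  have [measurable]: "Y \<in> borel_measurable M" using Y by (rule cx_dominated_measurable)
  interpret d: prob_space "distr M borel X" by (rule prob_space_distr) fact
  have id: "square_integrable (distr M borel X) (\<lambda>x. x)"
    using X by (simp add: square_integrable_distr)
  have TX: "cx_dominated \<nu> M (\<lambda>\<omega>. T (X \<omega>))"
    using T by (simp add: cx_dominated_distr)
  define g where "g x = x - T x" for x
  have [measurable]: "g \<in> borel_measurable borel" unfolding g_def by measurable
  have gX: "square_integrable M (\<lambda>\<omega>. g (X \<omega>))"
    unfolding g_def by (intro square_integrable_diff X sq TX)
  have obt: "(\<integral>\<omega>. g (X \<omega>) \<bullet> S (X \<omega>) \<partial>M) \<le> (\<integral>\<omega>. g (X \<omega>) \<bullet> T (X \<omega>) \<partial>M)"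
    if S: "cx_dominated \<nu> M (\<lambda>\<omega>. S (X \<omega>))" and [measurable]: "S \<in> borel_measurable borel" for S
  proof -
    have "(\<integral>x. (x - T x) \<bullet> (S x - T x) \<partial>distr M borel X) \<le> 0"
      using S by (intro d.cx_dominated_nearest_obtuse[OF \<nu> id T nearest]) (simp_all add: cx_dominated_distr)
    then have "(\<integral>\<omega>. g (X \<omega>) \<bullet> S (X \<omega>) - g (X \<omega>) \<bullet> T (X \<omega>) \<partial>M) \<le> 0"
      by (subst (asm) integral_distr) (simp_all add: g_def inner_diff_right)
    then show ?thesis
      using square_integrable_inner[OF gX sq[OF S]] square_integrable_inner[OF gX sq[OF TX]] by simp
  qed
  \<comment> \<open>The approximation takes base point 0, which turns the general distance bound
    into \<open>2 * norm (g x)\<close>. The factors 2 and 3 = 2 + 1 in the majorants below come from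
    here.\<close>
  obtain F where F: "\<And>i. simple_function borel (F i)" "\<And>x. (\<lambda>i. F i x) \<longlonglongrightarrow> g x"
    "\<And>i x. norm (F i x) \<le> 2 * norm (g x)"
    using borel_measurable_implies_sequence_metric[of g borel 0] by auto
  have [measurable]: "F i \<in> borel_measurable borel" for i
    by (rule borel_measurable_simple_function[OF F(1)])
  have FX: "square_integrable M (\<lambda>\<omega>. F i (X \<omega>))" for i
    unfolding square_integrable_def
  proof
    show "integrable M (\<lambda>\<omega>. (norm (F i (X \<omega>)))\<^sup>2)"
    proof (rule Bochner_Integration.integrable_bound[OF square_integrable_norm[OF square_integrable_scaleR[OF gX, of 2]]])
      show "AE \<omega> in M. norm ((norm (F i (X \<omega>)))\<^sup>2) \<le> norm ((norm (2 *\<^sub>R g (X \<omega>)))\<^sup>2)"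
        using F(3) by (intro AE_I2)
          (simp only: real_norm_def abs_power2 norm_scaleR abs_numeral power_mono norm_ge_zero)
    qed measurable
  qed measurable
  define B where "B = (\<integral>x. (norm x)\<^sup>2 \<partial>\<nu>)"
  define \<delta> where "\<delta> i = (\<integral>\<omega>. (norm (F i (X \<omega>) - g (X \<omega>)))\<^sup>2 \<partial>M)" for i
  have lim_\<delta>: "\<delta> \<longlonglongrightarrow> 0"
  proof -
    have "\<delta> \<longlonglongrightarrow> (\<integral>\<omega>. 0 \<partial>M)"
      unfolding \<delta>_def
    proof (rule integral_dominated_convergence)
      show "integrable M (\<lambda>\<omega>. (norm (3 *\<^sub>R g (X \<omega>)))\<^sup>2)"
        by (intro square_integrable_norm square_integrable_scaleR gX)
      show "AE \<omega> in M. (\<lambda>i. (norm (F i (X \<omega>) - g (X \<omega>)))\<^sup>2) \<longlonglongrightarrow> 0"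
      proof (intro AE_I2)
        fix \<omega>
        have "(\<lambda>i. (norm (F i (X \<omega>) - g (X \<omega>)))\<^sup>2) \<longlonglongrightarrow> (norm (g (X \<omega>) - g (X \<omega>)))\<^sup>2"
          by (intro tendsto_intros F)
        then show "(\<lambda>i. (norm (F i (X \<omega>) - g (X \<omega>)))\<^sup>2) \<longlonglongrightarrow> 0" by simp
      qed
      show "AE \<omega> in M. norm ((norm (F i (X \<omega>) - g (X \<omega>)))\<^sup>2) \<le> (norm (3 *\<^sub>R g (X \<omega>)))\<^sup>2" for i
      proof (intro AE_I2)
        fix \<omega>
        have "norm (F i (X \<omega>) - g (X \<omega>)) \<le> norm (3 *\<^sub>R g (X \<omega>))"
          using norm_triangle_ineq4[of "F i (X \<omega>)" "g (X \<omega>)"] F(3)[of i "X \<omega>"] by simp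
        then show "norm ((norm (F i (X \<omega>) - g (X \<omega>)))\<^sup>2) \<le> (norm (3 *\<^sub>R g (X \<omega>)))\<^sup>2"
          by (simp only: real_norm_def abs_power2 power_mono norm_ge_zero)
      qed
    qed measurable
    then show ?thesis by simp
  qed
  have lim_FY: "(\<lambda>i. \<integral>\<omega>. F i (X \<omega>) \<bullet> Y \<omega> \<partial>M) \<longlonglongrightarrow> (\<integral>\<omega>. g (X \<omega>) \<bullet> Y \<omega> \<partial>M)"
  proof (rule integral_dominated_convergence)
    show "integrable M (\<lambda>\<omega>. norm (2 *\<^sub>R g (X \<omega>)) * norm (Y \<omega>))"
      by (intro square_integrable_norm_mult square_integrable_scaleR gX sq Y)
    show "AE \<omega> in M. (\<lambda>i. F i (X \<omega>) \<bullet> Y \<omega>) \<longlonglongrightarrow> g (X \<omega>) \<bullet> Y \<omega>"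
      by (intro AE_I2 tendsto_intros F)
    show "AE \<omega> in M. norm (F i (X \<omega>) \<bullet> Y \<omega>) \<le> norm (2 *\<^sub>R g (X \<omega>)) * norm (Y \<omega>)" for i
    proof (intro AE_I2)
      fix \<omega>
      have "norm (F i (X \<omega>) \<bullet> Y \<omega>) \<le> norm (F i (X \<omega>)) * norm (Y \<omega>)"
        by (simp add: Cauchy_Schwarz_ineq2)
      also have "\<dots> \<le> norm (2 *\<^sub>R g (X \<omega>)) * norm (Y \<omega>)"
        using F(3)[of i "X \<omega>"] by (intro mult_right_mono) auto
      finally show "norm (F i (X \<omega>) \<bullet> Y \<omega>) \<le> norm (2 *\<^sub>R g (X \<omega>)) * norm (Y \<omega>)" .
    qed
  qed measurable
  \<comment> \<open>The conditional mean changes with \<open>i\<close> and no limit of it is taken.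
    Young's inequality separates the error of \<open>F i\<close> from the second moment of the
    conditional mean, which is at most \<open>B\<close> for every \<open>i\<close>.\<close>
  have step: "(\<integral>\<omega>. F i (X \<omega>) \<bullet> Y \<omega> \<partial>M) \<le> (\<integral>\<omega>. g (X \<omega>) \<bullet> T (X \<omega>) \<partial>M) + \<delta> i / e + e * B"
    if "0 < e" for i e
  proof -
    have "simple_function M (\<lambda>\<omega>. F i (X \<omega>))"
    proof -
      have "finite (F i ` X ` space M)"
        using F(1)[of i] by (auto simp: simple_function_def intro: finite_subset[rotated])
      then show ?thesis
        by (intro simple_function_borel_measurable) (auto simp: image_image)
    qed
    from cx_dominated_conditional_mean[OF \<nu> Y this] obtain c
      where dom: "cx_dominated \<nu> M (\<lambda>\<omega>. c (F i (X \<omega>)))"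
        and eq: "(\<integral>\<omega>. F i (X \<omega>) \<bullet> Y \<omega> \<partial>M) = (\<integral>\<omega>. F i (X \<omega>) \<bullet> c (F i (X \<omega>)) \<partial>M)"
      by blast
    have "simple_function borel (\<lambda>x. c (F i x))"
      using simple_function_compose[OF F(1), of c] by (simp add: comp_def)
    then have [measurable]: "(\<lambda>x. c (F i x)) \<in> borel_measurable borel"
      by (rule borel_measurable_simple_function)
    define S where "S \<omega> = c (F i (X \<omega>))" for \<omega>
    have S: "cx_dominated \<nu> M S" using dom by (simp add: S_def[abs_def])
    note ints = square_integrable_inner[OF gX sq[OF S]]
      square_integrable_norm[OF square_integrable_diff[OF FX[of i] gX]] square_integrable_norm[OF sq[OF S]]
    have "(\<integral>\<omega>. F i (X \<omega>) \<bullet> S \<omega> \<partial>M)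
        \<le> (\<integral>\<omega>. g (X \<omega>) \<bullet> S \<omega> + ((norm (F i (X \<omega>) - g (X \<omega>)))\<^sup>2 / e + e * (norm (S \<omega>))\<^sup>2) \<partial>M)"
    proof (intro integral_mono square_integrable_inner FX sq S)
      show "integrable M (\<lambda>\<omega>. g (X \<omega>) \<bullet> S \<omega> + ((norm (F i (X \<omega>) - g (X \<omega>)))\<^sup>2 / e + e * (norm (S \<omega>))\<^sup>2))"
        using ints by (intro Bochner_Integration.integrable_add) auto
      show "F i (X \<omega>) \<bullet> S \<omega> \<le> g (X \<omega>) \<bullet> S \<omega> + ((norm (F i (X \<omega>) - g (X \<omega>)))\<^sup>2 / e + e * (norm (S \<omega>))\<^sup>2)" for \<omega>
        using inner_le_young[OF that, of "F i (X \<omega>) - g (X \<omega>)" "S \<omega>"] by (simp add: inner_diff_left)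
    qed
    also have "\<dots> = (\<integral>\<omega>. g (X \<omega>) \<bullet> S \<omega> \<partial>M) + (\<delta> i / e + e * (\<integral>\<omega>. (norm (S \<omega>))\<^sup>2 \<partial>M))"
      using ints by (simp add: \<delta>_def)
    also have "\<dots> \<le> (\<integral>\<omega>. g (X \<omega>) \<bullet> T (X \<omega>) \<partial>M) + (\<delta> i / e + e * B)"
      using obt[of "\<lambda>x. c (F i x)"] S cx_dominated_square_integrable(2)[OF \<nu> S] that
      by (intro add_mono mult_left_mono) (auto simp: S_def[abs_def] B_def)
    finally show ?thesis by (simp add: eq S_def)
  qed
  \<comment> \<open>The order of limits matters: first \<open>i\<close> tends to infinity with
    \<open>e\<close> fixed, which removes \<open>\<delta> i / e\<close>, and only then
    \<open>e\<close> tends to 0.\<close>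
  have "(\<integral>\<omega>. g (X \<omega>) \<bullet> Y \<omega> \<partial>M) \<le> (\<integral>\<omega>. g (X \<omega>) \<bullet> T (X \<omega>) \<partial>M)"
  proof (rule le_if_le_add_scaled)
    show "0 \<le> B" by (simp add: B_def)
    fix e :: real assume e: "0 < e"
    have "(\<lambda>i. (\<integral>\<omega>. g (X \<omega>) \<bullet> T (X \<omega>) \<partial>M) + \<delta> i / e + e * B)
        \<longlonglongrightarrow> (\<integral>\<omega>. g (X \<omega>) \<bullet> T (X \<omega>) \<partial>M) + 0 / e + e * B"
      using e by (intro tendsto_intros lim_\<delta>) auto
    from LIMSEQ_le[OF lim_FY this] step[OF e]
    show "(\<integral>\<omega>. g (X \<omega>) \<bullet> Y \<omega> \<partial>M) \<le> (\<integral>\<omega>. g (X \<omega>) \<bullet> T (X \<omega>) \<partial>M) + e * B"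
      by auto
  qed
  then have "(\<integral>\<omega>. g (X \<omega>) \<bullet> (Y \<omega> - T (X \<omega>)) \<partial>M) \<le> 0"
    using square_integrable_inner[OF gX sq[OF Y]] square_integrable_inner[OF gX sq[OF TX]]
    by (simp add: inner_diff_right)
  then show ?thesis by (simp add: g_def)
qed

section \<open>Couplings and the Wasserstein distance\<close>

lemma couplings_prob_space:
  assumes "\<mu> \<in> P2" "\<pi> \<in> couplings \<mu> \<nu>"
  shows "prob_space \<pi>" "fst \<in> borel_measurable \<pi>" "snd \<in> borel_measurable \<pi>"
    "distr \<pi> borel fst = \<mu>" "distr \<pi> borel snd = \<nu>"
proof -
  have sets: "sets \<pi> = sets (borel \<Otimes>\<^sub>M borel)" and d: "distr \<pi> borel fst = \<mu>" "distr \<pi> borel snd = \<nu>"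
    using assms(2) by (auto simp: couplings_def)
  show m: "fst \<in> borel_measurable \<pi>" "snd \<in> borel_measurable \<pi>"
    by (simp_all add: measurable_cong_sets[OF sets refl])
  show "prob_space \<pi>"
    using prob_space_distrD[OF m(1)] d(1) P2_prob_space[OF assms(1)] by simp
qed (use assms(2) in \<open>auto simp: couplings_def\<close>)

lemma couplings_square_integrable:
  assumes "\<mu> \<in> P2" "\<nu> \<in> P2" "\<pi> \<in> couplings \<mu> \<nu>"
  shows "square_integrable \<pi> fst" "square_integrable \<pi> snd"
  using square_integrable_distr[of fst \<pi> borel "\<lambda>x. x"] square_integrable_distr[of snd \<pi> borel "\<lambda>x. x"]
    couplings_prob_space[OF assms(1,3)] P2_square_integrable[OF assms(1)] P2_square_integrable[OF assms(2)]
  by auto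

lemma distr_pair_couplings:
  assumes [measurable]: "X \<in> borel_measurable M" "Y \<in> borel_measurable M"
  shows "distr M (borel \<Otimes>\<^sub>M borel) (\<lambda>\<omega>. (X \<omega>, Y \<omega>)) \<in> couplings (distr M borel X) (distr M borel Y)"
  by (simp add: couplings_def distr_distr comp_def)

lemma couplings_nonempty:
  assumes "\<mu> \<in> P2" "\<nu> \<in> P2"
  shows "couplings \<mu> \<nu> \<noteq> {}"
proof -
  interpret m: prob_space \<mu> by (rule P2_prob_space[OF assms(1)])
  interpret n: prob_space \<nu> by (rule P2_prob_space[OF assms(2)])
  interpret pair_prob_space \<mu> \<nu> ..
  note s = assms[THEN P2_sets]
  have fst: "distr (\<mu> \<Otimes>\<^sub>M \<nu>) borel fst = \<mu>"
    using n.distr_pair_fst[of \<mu>] distr_cong[OF refl s(1), of "\<mu> \<Otimes>\<^sub>M \<nu>" fst fst] by simp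
  have "distr (\<mu> \<Otimes>\<^sub>M \<nu>) borel snd = \<nu>"
  proof (rule measure_eqI)
    fix A assume "A \<in> sets (distr (\<mu> \<Otimes>\<^sub>M \<nu>) borel snd)"
    then have A: "A \<in> sets \<nu>" by (simp add: s)
    have "snd \<in> \<mu> \<Otimes>\<^sub>M \<nu> \<rightarrow>\<^sub>M borel"
      using measurable_snd[of \<mu> \<nu>] measurable_cong_sets[OF refl s(2), of "\<mu> \<Otimes>\<^sub>M \<nu>"] by blast
    moreover have "snd -` A \<inter> space (\<mu> \<Otimes>\<^sub>M \<nu>) = space \<mu> \<times> A"
      using sets.sets_into_space[OF A] by (auto simp: space_pair_measure)
    ultimately show "emeasure (distr (\<mu> \<Otimes>\<^sub>M \<nu>) borel snd) A = emeasure \<nu> A"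
      using A n.emeasure_pair_measure_Times[OF sets.top[of \<mu>] A] s(2)
      by (simp add: emeasure_distr m.emeasure_space_1)
  qed (simp add: s)
  moreover have "sets (\<mu> \<Otimes>\<^sub>M \<nu>) = sets (borel \<Otimes>\<^sub>M borel)"
    using s by (intro sets_pair_measure_cong)
  ultimately show ?thesis
    using fst by (auto simp: couplings_def)
qed

lemma W2_nonneg: "\<mu> \<in> P2 \<Longrightarrow> \<nu> \<in> P2 \<Longrightarrow> 0 \<le> W2 \<mu> \<nu>"
  unfolding W2_def by (intro real_sqrt_ge_zero cINF_greatest couplings_nonempty) auto

lemma W2_power2:
  assumes "\<mu> \<in> P2" "\<nu> \<in> P2"
  shows "(W2 \<mu> \<nu>)\<^sup>2 = (INF \<pi>\<in>couplings \<mu> \<nu>. \<integral>z. (norm (fst z - snd z))\<^sup>2 \<partial>\<pi>)"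
  unfolding W2_def by (intro real_sqrt_pow2 cINF_greatest couplings_nonempty assms) auto

lemma W2_power2_le:
  assumes "\<mu> \<in> P2" "\<nu> \<in> P2" "\<pi> \<in> couplings \<mu> \<nu>"
  shows "(W2 \<mu> \<nu>)\<^sup>2 \<le> (\<integral>z. (norm (fst z - snd z))\<^sup>2 \<partial>\<pi>)"
  unfolding W2_power2[OF assms(1,2)] using assms(3)
  by (intro cINF_lower bdd_belowI[of _ 0]) auto

lemma W2_power2_greatest:
  assumes "\<mu> \<in> P2" "\<nu> \<in> P2"
    and "\<And>\<pi>. \<pi> \<in> couplings \<mu> \<nu> \<Longrightarrow> c \<le> (\<integral>z. (norm (fst z - snd z))\<^sup>2 \<partial>\<pi>)"
  shows "c \<le> (W2 \<mu> \<nu>)\<^sup>2"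
  unfolding W2_power2[OF assms(1,2)] using assms by (intro cINF_greatest couplings_nonempty) auto

text \<open>The joint law of \<open>X\<close> and \<open>Y\<close> is a coupling; every upper bound
  on \<open>W2\<close> between projections arises from variables on one space in this way.\<close>

lemma W2_distr_power2_le:
  assumes [measurable]: "X \<in> borel_measurable M" "Y \<in> borel_measurable M"
    and "distr M borel X \<in> P2" "distr M borel Y \<in> P2"
  shows "(W2 (distr M borel X) (distr M borel Y))\<^sup>2 \<le> (\<integral>\<omega>. (norm (X \<omega> - Y \<omega>))\<^sup>2 \<partial>M)"
proof -
  have "(W2 (distr M borel X) (distr M borel Y))\<^sup>2
      \<le> (\<integral>z. (norm (fst z - snd z))\<^sup>2 \<partial>distr M (borel \<Otimes>\<^sub>M borel) (\<lambda>\<omega>. (X \<omega>, Y \<omega>)))"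
    by (intro W2_power2_le distr_pair_couplings assms)
  also have "\<dots> = (\<integral>\<omega>. (norm (X \<omega> - Y \<omega>))\<^sup>2 \<partial>M)"
    by (subst integral_distr) simp_all
  finally show ?thesis .
qed

section \<open>Definiteness of the Wasserstein distance\<close>

text \<open>No coupling of cost 0 is assumed to exist: for each \<open>e\<close> one of small cost
  is chosen, and the distance is bounded by its square over \<open>e\<close> plus
  \<open>e\<close>.\<close>

lemma W2_eq_0_lipschitz_integral_le:
  fixes f :: "'a::euclidean_space \<Rightarrow> real"
  assumes P2: "\<mu> \<in> P2" "\<nu> \<in> P2" and W2: "W2 \<mu> \<nu> = 0"
    and f: "\<And>x y. \<bar>f x - f y\<bar> \<le> L * dist x y" "\<And>x. \<bar>f x\<bar> \<le> 1" and f_meas: "f \<in> borel_measurable borel"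
    and "0 \<le> L"
  shows "(\<integral>x. f x \<partial>\<mu>) \<le> (\<integral>x. f x \<partial>\<nu>)"
proof (rule le_if_le_add_scaled)
  show "0 \<le> L * 2" using \<open>0 \<le> L\<close> by simp
  fix e :: real assume e: "0 < e"
  \<comment> \<open>Cost below \<open>e\<^sup>2\<close> makes cost divided by \<open>e\<close> less
    than \<open>e\<close>, so the total error is at most \<open>e * (L * 2)\<close>.\<close>
  obtain \<pi> where \<pi>: "\<pi> \<in> couplings \<mu> \<nu>" and cost: "(\<integral>z. (norm (fst z - snd z))\<^sup>2 \<partial>\<pi>) < e\<^sup>2"
    using cInf_lessD[of "(\<lambda>\<pi>. \<integral>z. (norm (fst z - snd z))\<^sup>2 \<partial>\<pi>) ` couplings \<mu> \<nu>" "e\<^sup>2"]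
      couplings_nonempty[OF P2] W2_power2[OF P2] W2 e by auto
  interpret prob_space \<pi> by (rule couplings_prob_space(1)[OF P2(1) \<pi>])
  note meas[measurable] = couplings_prob_space(2,3)[OF P2(1) \<pi>] f_meas
  note d = couplings_prob_space(4,5)[OF P2(1) \<pi>]
  note sq = couplings_square_integrable[OF P2 \<pi>]
  have int_f: "integrable \<pi> (\<lambda>z. f (fst z))" "integrable \<pi> (\<lambda>z. f (snd z))"
    using f(2) by (auto intro!: integrable_const_bound[where B = 1])
  have eq: "(\<integral>x. f x \<partial>\<mu>) = (\<integral>z. f (fst z) \<partial>\<pi>)" "(\<integral>x. f x \<partial>\<nu>) = (\<integral>z. f (snd z) \<partial>\<pi>)"
    unfolding d[symmetric] by (rule integral_distr, measurable)+
  have int: "integrable \<pi> (\<lambda>z. (norm (fst z - snd z))\<^sup>2)"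
    by (intro square_integrable_norm square_integrable_diff sq)
  have "(\<integral>z. f (fst z) \<partial>\<pi>) \<le> (\<integral>z. f (snd z) + L * ((norm (fst z - snd z))\<^sup>2 / e + e) \<partial>\<pi>)"
  proof (intro integral_mono int_f)
    show "integrable \<pi> (\<lambda>z. f (snd z) + L * ((norm (fst z - snd z))\<^sup>2 / e + e))"
      using int int_f by simp
    fix z :: "'a \<times> 'a"
    have "dist (fst z) (snd z) \<le> (norm (fst z - snd z))\<^sup>2 / e + e"
      using inner_le_young[OF e, of "norm (fst z - snd z)" 1] by (simp add: dist_norm)
    then have "L * dist (fst z) (snd z) \<le> L * ((norm (fst z - snd z))\<^sup>2 / e + e)"
      using \<open>0 \<le> L\<close> by (rule mult_left_mono)
    then show "f (fst z) \<le> f (snd z) + L * ((norm (fst z - snd z))\<^sup>2 / e + e)"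
      using f(1)[of "fst z" "snd z"] by linarith
  qed
  also have "\<dots> = (\<integral>z. f (snd z) \<partial>\<pi>) + L * ((\<integral>z. (norm (fst z - snd z))\<^sup>2 \<partial>\<pi>) / e + e)"
    using int int_f by (simp add: prob_space)
  also have "\<dots> \<le> (\<integral>z. f (snd z) \<partial>\<pi>) + L * (e\<^sup>2 / e + e)"
    using cost e \<open>0 \<le> L\<close> by (intro add_left_mono mult_left_mono add_right_mono divide_right_mono) auto
  also have "\<dots> = (\<integral>z. f (snd z) \<partial>\<pi>) + e * (L * 2)"
    using e by (simp add: power2_eq_square)
  finally show "(\<integral>x. f x \<partial>\<mu>) \<le> (\<integral>x. f x \<partial>\<nu>) + e * (L * 2)"
    by (simp add: eq)
qed

text \<open>Lipschitz functions approximate the indicator of a closed set. The previous inequality,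
  applied to them and to their negatives, gives equal integrals, and closed sets are an
  intersection-stable generator of the Borel sets.\<close>

lemma W2_eq_0_imp_eq:
  fixes \<mu> \<nu> :: "'a::euclidean_space measure"
  assumes P2: "\<mu> \<in> P2" "\<nu> \<in> P2" and W2: "W2 \<mu> \<nu> = 0"
  shows "\<mu> = \<nu>"
proof -
  interpret m: prob_space \<mu> by (rule P2_prob_space[OF P2(1)])
  interpret n: prob_space \<nu> by (rule P2_prob_space[OF P2(2)])
  have closed_eq: "emeasure \<mu> A = emeasure \<nu> A" if A: "closed A" for A
  proof (cases "A = {}")
    case False
    \<comment> \<open>\<open>infdist\<close> to the empty set is 0 by convention, which would make
      \<open>f i\<close> constantly 1; hence the separate case for empty \<open>A\<close>.\<close>
    define f where "f i x = max 0 (1 - real i * infdist x A)" for i and x :: 'a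
    have f_lip: "\<bar>f i x - f i y\<bar> \<le> real i * dist x y" for i x y
    proof -
      have "\<bar>f i x - f i y\<bar> \<le> \<bar>real i * infdist y A - real i * infdist x A\<bar>"
        by (auto simp: f_def)
      also have "\<dots> = real i * \<bar>infdist y A - infdist x A\<bar>"
        unfolding right_diff_distrib[symmetric] abs_mult by simp
      also have "\<dots> \<le> real i * dist y x"
        by (intro mult_left_mono infdist_triangle_abs) simp
      finally show ?thesis by (simp only: dist_commute)
    qed
    have f_bound: "\<bar>f i x\<bar> \<le> 1" for i x
      by (simp add: f_def infdist_nonneg)
    have f_meas: "f i \<in> borel_measurable borel" for i
      unfolding f_def by (intro borel_measurable_continuous_onI continuous_intros)
    have f_lim: "(\<lambda>i. f i x) \<longlonglongrightarrow> indicat_real A x" for x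
    proof (cases "x \<in> A")
      case True
      then show ?thesis by (simp add: f_def)
    next
      case outside: False
      then have pos: "0 < infdist x A"
        using A False infdist_pos_not_in_closed by blast
      obtain N where N: "1 / infdist x A < real N" using reals_Archimedean2 by blast
      have "f i x = 0" if "N \<le> i" for i
      proof -
        have "1 \<le> real N * infdist x A" using N pos by (simp add: field_simps)
        also have "\<dots> \<le> real i * infdist x A" using that pos by (intro mult_right_mono) auto
        finally show ?thesis by (simp add: f_def)
      qed
      then show ?thesis
        using outside by (intro tendsto_eventually eventually_sequentiallyI[of N]) simp
    qed
    have le: "(\<integral>x. f i x \<partial>\<mu>) \<le> (\<integral>x. f i x \<partial>\<nu>)" for i
      by (rule W2_eq_0_lipschitz_integral_le[OF P2 W2 f_lip f_bound f_meas]) simp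
    have "(\<integral>x. - f i x \<partial>\<mu>) \<le> (\<integral>x. - f i x \<partial>\<nu>)" for i
    proof (rule W2_eq_0_lipschitz_integral_le[OF P2 W2])
      show "\<bar>- f i x - - f i y\<bar> \<le> real i * dist x y" for x y
        unfolding minus_diff_minus abs_minus_cancel by (rule f_lip)
      show "\<bar>- f i x\<bar> \<le> 1" for x
        unfolding abs_minus_cancel by (rule f_bound)
      show "(\<lambda>x. - f i x) \<in> borel_measurable borel"
        by (intro borel_measurable_uminus f_meas)
    qed simp
    with le have eq: "(\<integral>x. f i x \<partial>\<mu>) = (\<integral>x. f i x \<partial>\<nu>)" for i
      by (intro antisym) auto
    have lim: "(\<lambda>i. \<integral>x. f i x \<partial>\<rho>) \<longlonglongrightarrow> measure \<rho> A" if "\<rho> \<in> P2" for \<rho>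
    proof -
      interpret prob_space \<rho> by (rule P2_prob_space[OF that])
      have meas: "f i \<in> borel_measurable \<rho>" "indicat_real A \<in> borel_measurable \<rho>" for i
        unfolding measurable_cong_sets[OF P2_sets[OF that] refl]
        using f_meas A by (auto intro: borel_measurable_indicator)
      have "(\<lambda>i. \<integral>x. f i x \<partial>\<rho>) \<longlonglongrightarrow> (\<integral>x. indicat_real A x \<partial>\<rho>)"
        by (rule integral_dominated_convergence[where w = "\<lambda>_. 1"])
          (use meas f_lim f_bound in auto)
      moreover have "A \<in> sets \<rho>" using A by (simp add: P2_sets[OF that])
      ultimately show ?thesis by simp
    qed
    have "measure \<mu> A = measure \<nu> A"
      using lim[OF P2(1)] lim[OF P2(2)] unfolding eq by (rule LIMSEQ_unique)
    then show ?thesis by (simp add: m.emeasure_eq_measure n.emeasure_eq_measure)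
  qed simp
  show ?thesis
  proof (rule measure_eqI_generator_eq[where E = "Collect closed" and \<Omega> = UNIV and A = "\<lambda>_. UNIV"])
    show "sets \<mu> = sigma_sets UNIV (Collect closed)" "sets \<nu> = sigma_sets UNIV (Collect closed)"
      using P2_sets[OF P2(1)] P2_sets[OF P2(2)] by (simp_all add: borel_eq_closed)
    show "emeasure \<mu> A = emeasure \<nu> A" if "A \<in> Collect closed" for A
      using that closed_eq by simp
  qed (auto simp: Int_stable_def m.emeasure_eq_measure)
qed

section \<open>Identification of the minimizer\<close>

lemma cx_dominated_id_iff:
  assumes "\<eta> \<in> P2" "\<nu> \<in> P2"
  shows "cx_dominated \<nu> \<eta> (\<lambda>x. x) \<longleftrightarrow> \<eta> \<le>cx \<nu>"
  using convex_order_iff[OF assms] square_integrable_measurable[OF P2_square_integrable[OF assms(1)]]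
  by (auto simp: cx_dominated_def mean_def)

text \<open>Being dominated depends on the law only, so it transfers to the identity under the law
  of \<open>Y\<close>.\<close>

lemma (in prob_space) cx_dominated_law:
  fixes Y :: "'a \<Rightarrow> 'b::euclidean_space"
  assumes \<nu>: "\<nu> \<in> P2" and Y: "cx_dominated \<nu> M Y"
  shows "distr M borel Y \<in> P2" "distr M borel Y \<le>cx \<nu>"
proof -
  have [measurable]: "Y \<in> borel_measurable M" using Y by (rule cx_dominated_measurable)
  show P2: "distr M borel Y \<in> P2"
    using cx_dominated_square_integrable(1)[OF \<nu> Y]
    by (auto simp: P2_def prob_space_distr integrable_distr_eq square_integrable_def)
  have "cx_dominated \<nu> (distr M borel Y) (\<lambda>x. x)"
    using Y by (simp add: cx_dominated_distr)
  then show "distr M borel Y \<le>cx \<nu>"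
    by (simp add: cx_dominated_id_iff[OF P2 \<nu>])
qed

text \<open>The obtuse angle inequality at \<open>T\<close> gives
  \<open>W\<^sub>2\<^sup>2(\<mu>, \<eta>) \<ge> W\<^sub>2\<^sup>2(\<mu>, T\<^sub># \<mu>) + W\<^sub>2\<^sup>2(T\<^sub># \<mu>, \<eta>)\<close>; so uniqueness of the minimizer
  needs neither optimal couplings nor compactness.\<close>

lemma I2_eq_distr_nearest:
  fixes \<mu> \<nu> :: "'a::euclidean_space measure"
  assumes \<mu>: "\<mu> \<in> P2" and \<nu>: "\<nu> \<in> P2" and T: "cx_dominated \<nu> \<mu> T"
    and nearest: "\<And>S. cx_dominated \<nu> \<mu> S \<Longrightarrow>
      (\<integral>x. (norm (x - T x))\<^sup>2 \<partial>\<mu>) \<le> (\<integral>x. (norm (x - S x))\<^sup>2 \<partial>\<mu>)"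
  shows "I2 \<mu> \<nu> = distr \<mu> borel T"
proof -
  interpret m: prob_space \<mu> by (rule P2_prob_space[OF \<mu>])
  define \<eta>\<^sub>0 where "\<eta>\<^sub>0 = distr \<mu> borel T"
  define d where "d = (\<integral>x. (norm (x - T x))\<^sup>2 \<partial>\<mu>)"
  have \<eta>\<^sub>0: "\<eta>\<^sub>0 \<in> P2" "\<eta>\<^sub>0 \<le>cx \<nu>"
    unfolding \<eta>\<^sub>0_def by (rule m.cx_dominated_law[OF \<nu> T])+
  have T_meas: "T \<in> borel_measurable borel"
    using cx_dominated_measurable[OF T] measurable_cong_sets[OF P2_sets[OF \<mu>] refl, of borel] by blast
  have id: "(\<lambda>x. x) \<in> borel_measurable \<mu>"
    by (rule square_integrable_measurable[OF P2_square_integrable[OF \<mu>]])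
  have distr_id: "distr \<mu> borel (\<lambda>x. x) = \<mu>"
    by (rule distr_id2) (simp add: P2_sets[OF \<mu>])
  have upper: "(W2 \<mu> \<eta>\<^sub>0)\<^sup>2 \<le> d"
    using W2_distr_power2_le[OF id cx_dominated_measurable[OF T]] \<mu> \<eta>\<^sub>0
    by (simp add: distr_id \<eta>\<^sub>0_def d_def)
  \<comment> \<open>Under any coupling of \<mu> and \<eta> the second coordinate is a dominated
    variable, in general not a function of the first. The coupled variational inequality therefore
    applies with \<open>snd\<close> in the role of \<open>Y\<close>.\<close>
  have lower: "d + (W2 \<eta>\<^sub>0 \<eta>)\<^sup>2 \<le> (W2 \<mu> \<eta>)\<^sup>2" if \<eta>: "\<eta> \<in> P2" "\<eta> \<le>cx \<nu>" for \<eta>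
  proof (rule W2_power2_greatest[OF \<mu> \<eta>(1)])
    fix \<pi> assume \<pi>: "\<pi> \<in> couplings \<mu> \<eta>"
    interpret prob_space \<pi> by (rule couplings_prob_space(1)[OF \<mu> \<pi>])
    note meas[measurable] = couplings_prob_space(2,3)[OF \<mu> \<pi>] T_meas
    note fst = couplings_prob_space(4)[OF \<mu> \<pi>] and snd = couplings_prob_space(5)[OF \<mu> \<pi>]
    note sq = couplings_square_integrable[OF \<mu> \<eta>(1) \<pi>]
    have snd_dom: "cx_dominated \<nu> \<pi> snd"
      using cx_dominated_distr[OF meas(2), of "\<lambda>x. x" \<nu>] cx_dominated_id_iff[OF \<eta>(1) \<nu>] \<eta>(2) snd by simp
    have T_dom: "cx_dominated \<nu> \<pi> (\<lambda>z. T (fst z))"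
      using cx_dominated_distr[OF meas(1) T_meas, of \<nu>] T fst by simp
    note sqT = cx_dominated_square_integrable(1)[OF \<nu> T_dom]
    have obtuse: "(\<integral>z. (fst z - T (fst z)) \<bullet> (snd z - T (fst z)) \<partial>\<pi>) \<le> 0"
      by (rule cx_dominated_nearest_obtuse_coupled[OF \<nu> sq(1) _ _ snd_dom, unfolded fst]) (fact T nearest)+
    note ints = square_integrable_norm[OF square_integrable_diff[OF sq(1) sqT]]
      square_integrable_norm[OF square_integrable_diff[OF sqT sq(2)]]
      square_integrable_inner[OF square_integrable_diff[OF sq(1) sqT] square_integrable_diff[OF sq(2) sqT]]
    have "(norm (fst z - snd z))\<^sup>2 = (norm (fst z - T (fst z)))\<^sup>2 + (norm (T (fst z) - snd z))\<^sup>2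
        - 2 * ((fst z - T (fst z)) \<bullet> (snd z - T (fst z)))" for z
      using norm_add_scaleR_power2[of "fst z - T (fst z)" "-1" "snd z - T (fst z)"]
      by (simp add: norm_minus_commute)
    then have "(\<integral>z. (norm (fst z - snd z))\<^sup>2 \<partial>\<pi>) = (\<integral>z. (norm (fst z - T (fst z)))\<^sup>2 \<partial>\<pi>)
        + (\<integral>z. (norm (T (fst z) - snd z))\<^sup>2 \<partial>\<pi>) - 2 * (\<integral>z. (fst z - T (fst z)) \<bullet> (snd z - T (fst z)) \<partial>\<pi>)"
      using ints by simp
    moreover have "(\<integral>z. (norm (fst z - T (fst z)))\<^sup>2 \<partial>\<pi>) = d"
      unfolding d_def fst[symmetric] by (rule integral_distr[symmetric]) measurable
    moreover have "(W2 \<eta>\<^sub>0 \<eta>)\<^sup>2 \<le> (\<integral>z. (norm (T (fst z) - snd z))\<^sup>2 \<partial>\<pi>)"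
    proof -
      have "\<eta>\<^sub>0 = distr \<pi> borel (\<lambda>z. T (fst z))"
        unfolding \<eta>\<^sub>0_def fst[symmetric] by (subst distr_distr) (auto simp: comp_def)
      then show ?thesis
        using W2_distr_power2_le[of "\<lambda>z. T (fst z)" \<pi> snd] \<eta>\<^sub>0(1) \<eta>(1) snd by simp
    qed
    ultimately show "d + (W2 \<eta>\<^sub>0 \<eta>)\<^sup>2 \<le> (\<integral>z. (norm (fst z - snd z))\<^sup>2 \<partial>\<pi>)"
      using obtuse by linarith
  qed
  have min: "is_arg_min (W2 \<mu>) (\<lambda>\<eta>. \<eta> \<in> P2 \<and> \<eta> \<le>cx \<nu>) \<eta>\<^sub>0"
    unfolding is_arg_min_def
  proof safe
    fix \<eta> assume \<eta>: "\<eta> \<in> P2" "\<eta> \<le>cx \<nu>" "W2 \<mu> \<eta> < W2 \<mu> \<eta>\<^sub>0"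
    then have "(W2 \<mu> \<eta>)\<^sup>2 < (W2 \<mu> \<eta>\<^sub>0)\<^sup>2"
      using W2_nonneg[OF \<mu> \<eta>(1)] by (intro power_strict_mono) auto
    then show False
      using upper lower[OF \<eta>(1,2)] zero_le_power2[of "W2 \<eta>\<^sub>0 \<eta>"] by linarith
  qed (fact \<eta>\<^sub>0)+
  show ?thesis
    unfolding I2_def \<eta>\<^sub>0_def[symmetric]
  proof (rule the_equality)
    show "is_arg_min (W2 \<mu>) (\<lambda>\<eta>. \<eta> \<in> P2 \<and> \<eta> \<le>cx \<nu>) \<eta>\<^sub>0" by (rule min)
    fix \<eta> assume "is_arg_min (W2 \<mu>) (\<lambda>\<eta>. \<eta> \<in> P2 \<and> \<eta> \<le>cx \<nu>) \<eta>"
    then have \<eta>: "\<eta> \<in> P2" "\<eta> \<le>cx \<nu>" and "W2 \<mu> \<eta> \<le> W2 \<mu> \<eta>\<^sub>0"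
      using \<eta>\<^sub>0 by (auto simp: is_arg_min_def not_less)
    then have "(W2 \<mu> \<eta>)\<^sup>2 \<le> (W2 \<mu> \<eta>\<^sub>0)\<^sup>2"
      using W2_nonneg[OF \<mu> \<eta>(1)] by (intro power_mono) auto
    then have "(W2 \<eta>\<^sub>0 \<eta>)\<^sup>2 \<le> 0"
      using upper lower[OF \<eta>] by linarith
    then have "W2 \<eta>\<^sub>0 \<eta> = 0" by simp
    then show "\<eta> = \<eta>\<^sub>0"
      using W2_eq_0_imp_eq[OF \<eta>\<^sub>0(1) \<eta>(1)] by simp
  qed
qed

section \<open>Contraction under a coupling\<close>

theorem proposition2p2:
  fixes \<mu> \<mu>' \<nu> :: "(real ^ 'n) measure"
  assumes "\<mu> \<in> P2" and "\<mu>' \<in> P2" and "\<nu> \<in> P2"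
  shows "W2 (I2 \<mu> \<nu>) (I2 \<mu>' \<nu>) \<le> centered_W2 \<mu> \<mu>'"
proof -
  note \<mu> = assms(1) and \<mu>' = assms(2) and \<nu> = assms(3)
  interpret m: prob_space \<mu> by (rule P2_prob_space[OF \<mu>])
  interpret m': prob_space \<mu>' by (rule P2_prob_space[OF \<mu>'])
  obtain T where T: "cx_dominated \<nu> \<mu> T"
    and T_nearest: "\<And>S. cx_dominated \<nu> \<mu> S \<Longrightarrow> (\<integral>x. (norm (x - T x))\<^sup>2 \<partial>\<mu>) \<le> (\<integral>x. (norm (x - S x))\<^sup>2 \<partial>\<mu>)"
    using m.cx_dominated_nearest_exists[OF \<nu> P2_square_integrable[OF \<mu>]] by blast
  obtain T' where T': "cx_dominated \<nu> \<mu>' T'"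
    and T'_nearest: "\<And>S. cx_dominated \<nu> \<mu>' S \<Longrightarrow> (\<integral>x. (norm (x - T' x))\<^sup>2 \<partial>\<mu>') \<le> (\<integral>x. (norm (x - S x))\<^sup>2 \<partial>\<mu>')"
    using m'.cx_dominated_nearest_exists[OF \<nu> P2_square_integrable[OF \<mu>']] by blast
  have I2: "I2 \<mu> \<nu> = distr \<mu> borel T" "I2 \<mu>' \<nu> = distr \<mu>' borel T'"
    using I2_eq_distr_nearest[OF \<mu> \<nu> T T_nearest] I2_eq_distr_nearest[OF \<mu>' \<nu> T' T'_nearest] by auto
  have I2_P2: "I2 \<mu> \<nu> \<in> P2" "I2 \<mu>' \<nu> \<in> P2"
    unfolding I2 by (rule m.cx_dominated_law[OF \<nu> T] m'.cx_dominated_law[OF \<nu> T'])+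
  have meas[measurable]: "T \<in> borel_measurable borel" "T' \<in> borel_measurable borel"
    using cx_dominated_measurable[OF T] measurable_cong_sets[OF P2_sets[OF \<mu>] refl, of borel]
      cx_dominated_measurable[OF T'] measurable_cong_sets[OF P2_sets[OF \<mu>'] refl, of borel] by blast+
  define \<delta> where "\<delta> = mean \<mu> - mean \<mu>'"
  have "(W2 (I2 \<mu> \<nu>) (I2 \<mu>' \<nu>))\<^sup>2 + (norm \<delta>)\<^sup>2 \<le> (W2 \<mu> \<mu>')\<^sup>2"
  \<comment> \<open>The shift \<delta> is the same for all couplings, so the bound can be proved for
    each one separately before the infimum is taken.\<close>
  proof (rule W2_power2_greatest[OF \<mu> \<mu>'])
    fix \<pi> assume \<pi>: "\<pi> \<in> couplings \<mu> \<mu>'"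
    interpret prob_space \<pi> by (rule couplings_prob_space(1)[OF \<mu> \<pi>])
    note [measurable] = couplings_prob_space(2,3)[OF \<mu> \<pi>]
    note fst = couplings_prob_space(4)[OF \<mu> \<pi>] and snd = couplings_prob_space(5)[OF \<mu> \<pi>]
    note sq = couplings_square_integrable[OF \<mu> \<mu>' \<pi>]
    define Z where "Z z = T (fst z)" for z :: "(real ^ 'n) \<times> (real ^ 'n)"
    define Z' where "Z' z = T' (snd z)" for z :: "(real ^ 'n) \<times> (real ^ 'n)"
    have Z: "cx_dominated \<nu> \<pi> Z"
      unfolding Z_def[abs_def] using cx_dominated_distr[of fst \<pi> borel T \<nu>] T fst by simp
    have Z': "cx_dominated \<nu> \<pi> Z'"
      unfolding Z'_def[abs_def] using cx_dominated_distr[of snd \<pi> borel T' \<nu>] T' snd by simp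
    note sqZ = cx_dominated_square_integrable(1)[OF \<nu> Z] cx_dominated_square_integrable(1)[OF \<nu> Z']
    note [measurable] = sqZ[THEN square_integrable_measurable]
    define D where "D z = Z z - Z' z" for z
    have sqD: "square_integrable \<pi> D"
      unfolding D_def[abs_def] by (intro square_integrable_diff sqZ)
    have mean_D: "(\<integral>z. D z \<partial>\<pi>) = 0"
      using sqZ[THEN square_integrable_integrable] cx_dominated_mean[OF Z] cx_dominated_mean[OF Z']
      by (simp add: D_def)
    have obtuse: "(\<integral>z. (fst z - Z z) \<bullet> (Z' z - Z z) \<partial>\<pi>) \<le> 0"
      unfolding Z_def by (rule cx_dominated_nearest_obtuse_coupled[OF \<nu> sq(1) _ _ Z', unfolded fst])
        (fact T T_nearest)+
    have obtuse': "(\<integral>z. (snd z - Z' z) \<bullet> (Z z - Z' z) \<partial>\<pi>) \<le> 0"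
      unfolding Z'_def by (rule cx_dominated_nearest_obtuse_coupled[OF \<nu> sq(2) _ _ Z, unfolded snd])
        (fact T' T'_nearest)+
    \<comment> \<open>\<open>U\<close> is the centered difference of the coordinates. Since
      \<open>D\<close> has integral 0, adding the constant \<delta> to \<open>U\<close> does not
      change the integral of its inner product with \<open>D\<close>.\<close>
    define U where "U z = fst z - snd z - \<delta>" for z
    have sqU: "square_integrable \<pi> U"
      unfolding U_def[abs_def] by (intro square_integrable_diff sq square_integrable_const)
    note ints = square_integrable_norm[OF sqD] square_integrable_norm[OF sqU] square_integrable_inner[OF sqU sqD]
      square_integrable_integrable[OF sqD]
      square_integrable_inner[OF square_integrable_diff[OF sq(1) sqZ(1)] square_integrable_diff[OF sqZ(2) sqZ(1)]]
      square_integrable_inner[OF square_integrable_diff[OF sq(2) sqZ(2)] square_integrable_diff[OF sqZ(1) sqZ(2)]]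
    \<comment> \<open>The two obtuse-angle terms add up to the squared norm of \<open>D\<close>
      minus its inner product with \<open>fst z - snd z\<close>. Each is tested with the other
      projection as competitor.\<close>
    have "(norm (D z))\<^sup>2 = U z \<bullet> D z + \<delta> \<bullet> D z
        + ((fst z - Z z) \<bullet> (Z' z - Z z) + (snd z - Z' z) \<bullet> (Z z - Z' z))" for z
      by (simp add: U_def D_def power2_norm_eq_inner inner_diff_left inner_diff_right)
    then have "(\<integral>z. (norm (D z))\<^sup>2 \<partial>\<pi>) = (\<integral>z. U z \<bullet> D z \<partial>\<pi>) + \<delta> \<bullet> (\<integral>z. D z \<partial>\<pi>)
        + ((\<integral>z. (fst z - Z z) \<bullet> (Z' z - Z z) \<partial>\<pi>) + (\<integral>z. (snd z - Z' z) \<bullet> (Z z - Z' z) \<partial>\<pi>))"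
      using ints by simp
    then have "(\<integral>z. (norm (D z))\<^sup>2 \<partial>\<pi>) \<le> (\<integral>z. U z \<bullet> D z \<partial>\<pi>)"
      using obtuse obtuse' mean_D by simp
    \<comment> \<open>The squared norm of \<open>U - D\<close> is integrated in place of a
      Cauchy-Schwarz inequality for integrals; this already gives the comparison of second
      moments.\<close>
    moreover have "0 \<le> (\<integral>z. (norm (U z))\<^sup>2 + (norm (D z))\<^sup>2 - 2 * (U z \<bullet> D z) \<partial>\<pi>)"
    proof (rule Bochner_Integration.integral_nonneg)
      fix z
      show "0 \<le> (norm (U z))\<^sup>2 + (norm (D z))\<^sup>2 - 2 * (U z \<bullet> D z)"
        using zero_le_power2[of "norm (U z + (- 1) *\<^sub>R D z)"]
        unfolding norm_add_scaleR_power2 by simp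
    qed
    ultimately have D_le_U: "(\<integral>z. (norm (D z))\<^sup>2 \<partial>\<pi>) \<le> (\<integral>z. (norm (U z))\<^sup>2 \<partial>\<pi>)"
      using ints by simp
    have "(W2 (I2 \<mu> \<nu>) (I2 \<mu>' \<nu>))\<^sup>2 \<le> (\<integral>z. (norm (D z))\<^sup>2 \<partial>\<pi>)"
    proof -
      have "I2 \<mu> \<nu> = distr \<pi> borel Z" "I2 \<mu>' \<nu> = distr \<pi> borel Z'"
        using distr_distr[of T borel borel fst \<pi>] distr_distr[of T' borel borel snd \<pi>]
        by (simp_all add: I2 fst snd comp_def Z_def[abs_def] Z'_def[abs_def])
      then show ?thesis
        using W2_distr_power2_le[of Z \<pi> Z'] I2_P2 by (simp add: D_def)
    qed
    \<comment> \<open>The variance identity: \<delta> is the mean of \<open>fst z - snd z\<close>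
      under every coupling, so centering removes exactly the squared norm of \<delta>.\<close>
    moreover have "(\<integral>z. (norm (U z))\<^sup>2 \<partial>\<pi>) = (\<integral>z. (norm (fst z - snd z))\<^sup>2 \<partial>\<pi>) - (norm \<delta>)\<^sup>2"
    proof -
      define V where "V z = fst z - snd z" for z :: "(real ^ 'n) \<times> (real ^ 'n)"
      have sqV: "square_integrable \<pi> V"
        unfolding V_def[abs_def] by (intro square_integrable_diff sq)
      have "mean \<mu> = (\<integral>z. fst z \<partial>\<pi>)" "mean \<mu>' = (\<integral>z. snd z \<partial>\<pi>)"
        unfolding mean_def fst[symmetric] snd[symmetric] by (rule integral_distr; measurable)+
      then have mean_V: "(\<integral>z. V z \<partial>\<pi>) = \<delta>"
        using sq[THEN square_integrable_integrable] by (simp add: V_def \<delta>_def)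
      have "(norm (U z))\<^sup>2 = (norm (V z))\<^sup>2 - 2 * (\<delta> \<bullet> V z) + (norm \<delta>)\<^sup>2" for z
        using norm_add_scaleR_power2[of "V z" "-1" \<delta>] by (simp add: U_def V_def inner_commute)
      then have "(\<integral>z. (norm (U z))\<^sup>2 \<partial>\<pi>)
          = (\<integral>z. (norm (V z))\<^sup>2 \<partial>\<pi>) - 2 * (\<delta> \<bullet> (\<integral>z. V z \<partial>\<pi>)) + (norm \<delta>)\<^sup>2"
        using square_integrable_norm[OF sqV] square_integrable_integrable[OF sqV]
        by (simp add: prob_space)
      then show ?thesis
        unfolding mean_V V_def[symmetric] by (simp add: dot_square_norm)
    qed
    ultimately show "(W2 (I2 \<mu> \<nu>) (I2 \<mu>' \<nu>))\<^sup>2 + (norm \<delta>)\<^sup>2 \<le> (\<integral>z. (norm (fst z - snd z))\<^sup>2 \<partial>\<pi>)"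
      using D_le_U by linarith
  qed
  then show ?thesis
    unfolding centered_W2_def \<delta>_def by (intro real_le_rsqrt) simp
qed

end
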